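(* Let $p\in\mathbb{R}[x_1,x_2]$ be a bivariate real-zero polynomial of total degree $d>0$ with $p(0,0)=1$. Then there exist $d\times d$ (complex) Hermitian matrices $A_1$ and $A_2$ such that $$p(x_1,x_2)=\det\bigl(I+x_1A_1+x_2A_2\bigr),$$ where $I$ is the $d\times d$ identity matrix.
   Context: A polynomial $p\in\mathbb{R}[x_1,x_2]$ is a real-zero polynomial if for every $(x_1,x_2)\in\mathbb{R}^2$ the one-variable polynomial $t\mapsto p(tx_1,tx_2)$ has only real zeros. *)

theory Defs
  imports
    Complex_Main
    "HOL-Computational_Algebra.Polynomial"
    "Jordan_Normal_Form.Determinant"
    "Jordan_Normal_Form.Schur_Decomposition"
begin

text \<open>A bivariate polynomial is an element of \<open>R[x1][x2]\<close>: the coefficient of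
  \<open>x1 ^ i * x2 ^ j\<close> in \<open>p\<close> is \<open>coeff (coeff p j) i\<close>.\<close>

definition eval2 :: "'a::comm_semiring_0 poly poly \<Rightarrow> 'a \<Rightarrow> 'a \<Rightarrow> 'a" where
  "eval2 p x1 x2 = poly (poly p [:x2:]) x1"

text \<open>The \<open>0\<close> inserted below only serves to give the zero polynomial degree \<open>0\<close>.\<close>

definition total_degree :: "'a::zero poly poly \<Rightarrow> nat" where
  "total_degree p = Max (insert 0 {i + j | i j. coeff (coeff p j) i \<noteq> 0})"

definition complexify :: "real poly poly \<Rightarrow> complex poly poly" where
  "complexify p = map_poly (map_poly complex_of_real) p"

text \<open>The zeros of \<open>t \<mapsto> p (t x1, t x2)\<close> are its complex zeros. If this
  polynomial is identically zero for some \<open>(x1, x2)\<close> (which requires \<open>p (0, 0) = 0\<close>),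
  then \<open>p\<close> does not count as a real-zero polynomial.\<close>

definition real_zero_poly :: "real poly poly \<Rightarrow> bool" where
  "real_zero_poly p \<longleftrightarrow>
     (\<forall>(x1::real) (x2::real) (t::complex).
        eval2 (complexify p) (t * complex_of_real x1) (t * complex_of_real x2) = 0
        \<longrightarrow> t \<in> \<real>)"

definition hermitian_mat :: "complex mat \<Rightarrow> bool" where
  "hermitian_mat A \<longleftrightarrow> mat_adjoint A = A"

lemma finite_support: "finite {i + j | i j. coeff (coeff p j) i \<noteq> 0}"
proof (rule finite_subset)
  show "{i + j | i j. coeff (coeff p j) i \<noteq> 0}
      \<subseteq> (\<Union>j\<in>{..degree p}. (\<lambda>i. i + j) ` {..degree (coeff p j)})"
  proof (safe)
    fix i j assume *: "coeff (coeff p j) i \<noteq> 0"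
    then have "i \<le> degree (coeff p j)" by (rule le_degree)
    moreover from * have "coeff p j \<noteq> 0" by auto
    then have "j \<le> degree p" by (rule le_degree)
    ultimately show "i + j \<in> (\<Union>j\<in>{..degree p}. (\<lambda>i. i + j) ` {..degree (coeff p j)})"
      by blast
  qed
qed simp

lemma hermitian_mat_iff:
  assumes A: "A \<in> carrier_mat n n"
  shows "hermitian_mat A \<longleftrightarrow> (\<forall>i<n. \<forall>j<n. A $$ (i, j) = cnj (A $$ (j, i)))"
proof -
  have dim: "dim_row (mat_adjoint A) = n" "dim_col (mat_adjoint A) = n"
    using A by (auto simp: mat_adjoint_def)
  have ent: "mat_adjoint A $$ (i, j) = cnj (A $$ (j, i))" if "i < n" "j < n" for i j
    using A that by (simp add: mat_adjoint_def mat_of_rows_def conjugate_complex_def)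
  show ?thesis
    unfolding hermitian_mat_def mat_eq_iff using A dim ent by (simp; metis)
qed

end

theory Submission
  imports Defs
begin

text \<open>
  Let \<open>q\<^sub>x(t) = t\<^sup>d p(x/t, 1/t)\<close>, a monic polynomial in \<open>t\<close> with polynomial coefficients in \<open>x\<close> and
  only real roots for real \<open>x\<close>. Applying Euclid's algorithm to \<open>q\<^sub>x\<close> and its derivative over the
  field of rational functions of \<open>x\<close> gives a three-term recurrence \<open>q = (t - a) q\<^sub>1 - \<beta> q\<^sub>2\<close>. The
  Bezout kernel of each consecutive pair is positive semidefinite, so \<open>\<beta> \<ge> 0\<close> on the real line and
  \<open>\<beta> = b b\<^sup>*\<close> by the scalar Fejer--Riesz theorem. If \<open>\<beta>\<close> vanishes identically, the algorithm
  restarts with the derivative of \<open>q\<^sub>1\<close>. The resulting Jacobi matrix \<open>M(x)\<close> is Hermitian on the real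
  line, has rational entries and characteristic polynomial \<open>q\<^sub>x\<close>.

  The poles of \<open>M\<close> off the real line are removed by conjugation with Blaschke--Potapov factors,
  which are unitary on the real line: by Cayley--Hamilton \<open>M\<close> preserves a lattice over the
  polynomials, and each factor moves a zero of the determinant of the lattice out of the upper
  half-plane. Once none is left, \<open>M\<close> has no pole in the upper half-plane, and by symmetry none in
  the lower one. Finally \<open>\<Sum> |M\<^sub>i\<^sub>j|\<^sup>2 = tr M\<^sup>2\<close> is a polynomial of degree at most 2 in \<open>x\<close> because it
  is the sum of the squares of the roots of \<open>q\<^sub>x\<close>. This excludes real poles and shows that \<open>M\<close> is
  linear in \<open>x\<close>.
\<close>

section \<open>Rational functions on the real line\<close>

lemma eventually_cofinite_poly_neq_0:
  fixes g :: "complex poly"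
  assumes "g \<noteq> 0"
  shows "\<forall>\<^sub>F x::real in cofinite. poly g (of_real x) \<noteq> 0"
proof -
  have "finite {z. poly g z = 0}" using assms by (rule poly_roots_finite)
  then have "finite (complex_of_real -` {z. poly g z = 0})"
    by (rule finite_vimageI) (simp add: inj_def)
  then show ?thesis by (simp add: eventually_cofinite vimage_def)
qed

text \<open>Identities shown for almost all real \<open>x\<close> become polynomial identities and
  can then be evaluated at nonreal points. This is how information leaves the real line.\<close>

lemma poly_eq_if_cofinite_real:
  fixes f g :: "complex poly"
  assumes "\<forall>\<^sub>F x::real in cofinite. poly f (of_real x) = poly g (of_real x)"
  shows "f = g"
proof (rule ccontr)
  assume "f \<noteq> g"
  then have "f - g \<noteq> 0" by simp
  from eventually_conj[OF eventually_cofinite_poly_neq_0[OF this] assms]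
  have "\<forall>\<^sub>F x::real in cofinite. False" by (rule eventually_mono) simp
  then show False by (simp add: infinite_UNIV_char_0)
qed

lemma eventually_cofinite_at:
  fixes a :: real
  assumes "eventually P cofinite"
  shows "eventually P (at a)"
proof -
  have "finite ({x. \<not> P x} - {a})" using assms by (simp add: eventually_cofinite)
  then have "open (- ({x. \<not> P x} - {a}))" by (intro open_Compl finite_imp_closed)
  then have "eventually (\<lambda>x. x \<in> - ({x. \<not> P x} - {a})) (nhds a)"
    by (rule eventually_nhds_in_open) simp
  then show ?thesis unfolding eventually_at_filter by (rule eventually_mono) auto
qed

text \<open>Every point is a limit of points outside a given finite set, so finitely many exceptions
  do no harm to a non-strict inequality.\<close>

lemma continuous_le_if_cofinite:
  fixes f g :: "real \<Rightarrow> real"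
  assumes "\<forall>\<^sub>F x in cofinite. f x \<le> g x" "isCont f a" "isCont g a"
  shows "f a \<le> g a"
proof (rule tendsto_le[of "at a"])
  show "(g \<longlongrightarrow> g a) (at a)" "(f \<longlongrightarrow> f a) (at a)"
    using assms by (auto simp: isCont_def)
  show "\<forall>\<^sub>F x in at a. f x \<le> g x" by (rule eventually_cofinite_at[OF assms(1)])
qed simp

lemma isCont_poly_of_real [continuous_intros]:
  "isCont (\<lambda>x::real. poly p (complex_of_real x)) a"
  by (intro continuous_intros)

text \<open>Rational functions are handled as functions on the real line, up to finite sets.\<close>

definition ratf :: "(real \<Rightarrow> complex) \<Rightarrow> bool" where
  "ratf f \<longleftrightarrow> (\<exists>g h. g \<noteq> 0 \<and> (\<forall>\<^sub>F x in cofinite. poly g (of_real x) * f x = poly h (of_real x)))"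

lemma ratf_poly [intro, simp]: "ratf (\<lambda>x. poly p (of_real x))"
  unfolding ratf_def by (intro exI[of _ 1] exI[of _ p]) auto

lemma ratf_const [intro, simp]: "ratf (\<lambda>x. c)"
  using ratf_poly[of "[:c:]"] by simp

lemma ratf_cong_cofinite:
  assumes "ratf f" "\<forall>\<^sub>F x in cofinite. f x = g x"
  shows "ratf g"
proof -
  obtain d h where d: "d \<noteq> 0" and e: "\<forall>\<^sub>F x in cofinite. poly d (of_real x) * f x = poly h (of_real x)"
    using assms(1) unfolding ratf_def by blast
  have "\<forall>\<^sub>F x in cofinite. poly d (of_real x) * g x = poly h (of_real x)"
    using e assms(2) by eventually_elim simp
  then show ?thesis using d unfolding ratf_def by blast
qed

lemma ratf_add [intro]:
  assumes "ratf f" "ratf g" shows "ratf (\<lambda>x. f x + g x)"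
proof -
  obtain d h where d: "d \<noteq> 0" and e: "\<forall>\<^sub>F x in cofinite. poly d (of_real x) * f x = poly h (of_real x)"
    using assms(1) unfolding ratf_def by blast
  obtain d' h' where d': "d' \<noteq> 0" and e': "\<forall>\<^sub>F x in cofinite. poly d' (of_real x) * g x = poly h' (of_real x)"
    using assms(2) unfolding ratf_def by blast
  have "\<forall>\<^sub>F x in cofinite. poly (d*d') (of_real x) * (f x + g x) = poly (d' * h + d * h') (of_real x)"
    using e e' by eventually_elim (simp add: algebra_simps flip: mult.assoc)
  then show ?thesis using d d' unfolding ratf_def by (metis mult_eq_0_iff)
qed

lemma ratf_mult [intro]:
  assumes "ratf f" "ratf g" shows "ratf (\<lambda>x. f x * g x)"
proof -
  obtain d h where d: "d \<noteq> 0" and e: "\<forall>\<^sub>F x in cofinite. poly d (of_real x) * f x = poly h (of_real x)"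
    using assms(1) unfolding ratf_def by blast
  obtain d' h' where d': "d' \<noteq> 0" and e': "\<forall>\<^sub>F x in cofinite. poly d' (of_real x) * g x = poly h' (of_real x)"
    using assms(2) unfolding ratf_def by blast
  have "\<forall>\<^sub>F x in cofinite. poly (d*d') (of_real x) * (f x * g x) = poly (h * h') (of_real x)"
    using e e'
  proof eventually_elim
    case (elim x)
    have "poly (d*d') (of_real x) * (f x * g x) = (poly d (of_real x) * f x) * (poly d' (of_real x) * g x)"
      by (simp add: mult_ac)
    then show ?case using elim by simp
  qed
  then show ?thesis using d d' unfolding ratf_def by (metis mult_eq_0_iff)
qed

lemma ratf_uminus [intro]: "ratf f \<Longrightarrow> ratf (\<lambda>x. - f x)"
  using ratf_mult[OF ratf_const[of "-1"], of f] by simp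

lemma ratf_diff [intro]: "ratf f \<Longrightarrow> ratf g \<Longrightarrow> ratf (\<lambda>x. f x - g x)"
  using ratf_add[OF _ ratf_uminus, of f g] by simp

lemma ratf_sum [intro]: "(\<And>i. i \<in> I \<Longrightarrow> ratf (f i)) \<Longrightarrow> ratf (\<lambda>x. \<Sum>i\<in>I. f i x)"
  by (induction I rule: infinite_finite_induct) auto

lemma ratf_if: "(P \<Longrightarrow> ratf f) \<Longrightarrow> (\<not> P \<Longrightarrow> ratf g) \<Longrightarrow> ratf (\<lambda>x. if P then f x else g x)"
  by (cases P) auto

text \<open>This replaces the zero test in the field of rational functions: the numerator
  \<open>h\<close> is zero or has only finitely many real roots. It decides whether a step of
  Euclid's algorithm breaks down.\<close>

lemma ratf_zero_or_neq_0:
  assumes "ratf f"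
  shows "(\<forall>\<^sub>F x in cofinite. f x = 0) \<or> (\<forall>\<^sub>F x in cofinite. f x \<noteq> 0)"
proof -
  obtain d h where d: "d \<noteq> 0" and e: "\<forall>\<^sub>F x in cofinite. poly d (of_real x) * f x = poly h (of_real x)"
    using assms(1) unfolding ratf_def by blast
  show ?thesis
  proof (cases "h = 0")
    case True
    have "\<forall>\<^sub>F x in cofinite. f x = 0"
      using e eventually_cofinite_poly_neq_0[OF d] by eventually_elim (simp add: True)
    then show ?thesis ..
  next
    case False
    have "\<forall>\<^sub>F x in cofinite. f x \<noteq> 0"
      using e eventually_cofinite_poly_neq_0[OF False] by eventually_elim auto
    then show ?thesis ..
  qed
qed

lemma ratf_inverse [intro]:
  assumes "ratf f" shows "ratf (\<lambda>x. inverse (f x))"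
proof -
  obtain d h where d: "d \<noteq> 0" and e: "\<forall>\<^sub>F x in cofinite. poly d (of_real x) * f x = poly h (of_real x)"
    using assms(1) unfolding ratf_def by blast
  show ?thesis
  proof (cases "h = 0")
    case True
    \<comment> \<open>Here \<open>f\<close> vanishes almost everywhere, and the convention
      \<open>inverse 0 = 0\<close> keeps the inverse rational.\<close>
    have "\<forall>\<^sub>F x in cofinite. 0 = inverse (f x)"
      using e eventually_cofinite_poly_neq_0[OF d] by eventually_elim (simp add: True)
    then show ?thesis by (rule ratf_cong_cofinite[OF ratf_const])
  next
    case False
    have "\<forall>\<^sub>F x in cofinite. poly h (of_real x) * inverse (f x) = poly d (of_real x)"
      using e eventually_cofinite_poly_neq_0[OF False]
    proof eventually_elim
      case (elim x)
      then have "f x \<noteq> 0" by auto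
      then show ?case using elim by (simp add: field_simps)
    qed
    then show ?thesis using False unfolding ratf_def by blast
  qed
qed

lemma ratf_divide [intro]: "ratf f \<Longrightarrow> ratf g \<Longrightarrow> ratf (\<lambda>x. f x / g x)"
  unfolding divide_inverse by auto

lemma ratf_cnj [intro]:
  assumes "ratf f" shows "ratf (\<lambda>x. cnj (f x))"
proof -
  obtain d h where d: "d \<noteq> 0" and e: "\<forall>\<^sub>F x in cofinite. poly d (of_real x) * f x = poly h (of_real x)"
    using assms(1) unfolding ratf_def by blast
  have "\<forall>\<^sub>F x in cofinite. poly (map_poly cnj d) (of_real x) * cnj (f x) = poly (map_poly cnj h) (of_real x)"
    using e by eventually_elim (metis complex_cnj_mult complex_cnj_complex_of_real poly_cnj)
  moreover have "map_poly cnj d \<noteq> 0" using d by (simp add: map_poly_eq_0_iff)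
  ultimately show ?thesis unfolding ratf_def by blast
qed

lemma ratf_common_denominator:
  assumes "finite I" "\<And>i. i \<in> I \<Longrightarrow> ratf (f i)"
  shows "\<exists>d h. d \<noteq> 0 \<and> (\<forall>i\<in>I. \<forall>\<^sub>F x in cofinite. poly d (of_real x) * f i x = poly (h i) (of_real x))"
  using assms
proof (induction I rule: finite_induct)
  case empty
  show ?case by (rule exI[of _ 1]) simp
next
  case (insert j I)
  then obtain d h where d: "d \<noteq> 0"
    and e: "\<And>i. i \<in> I \<Longrightarrow> \<forall>\<^sub>F x in cofinite. poly d (of_real x) * f i x = poly (h i) (of_real x)"
    by auto
  have "ratf (f j)" using insert.prems by simp
  then obtain d' h' where d': "d' \<noteq> 0"
    and e': "\<forall>\<^sub>F x in cofinite. poly d' (of_real x) * f j x = poly h' (of_real x)"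
    unfolding ratf_def by blast
  define k where "k i = (if i = j then d * h' else d' * h i)" for i
  have "\<forall>\<^sub>F x in cofinite. poly (d * d') (of_real x) * f i x = poly (k i) (of_real x)"
    if "i \<in> insert j I" for i
  proof (cases "i = j")
    case True
    show ?thesis using e' by eventually_elim (simp add: True k_def mult_ac)
  next
    case False
    then have "i \<in> I" using that by simp
    from e[OF this] show ?thesis by eventually_elim (simp add: False k_def mult_ac)
  qed
  then show ?case using d d' by (intro exI[of _ "d * d'"] exI[of _ k]) auto
qed

section \<open>Fejer--Riesz factorization on the real line\<close>

lemma poly_nonneg_real_if_cofinite:
  fixes r :: "complex poly" and x :: real
  assumes "\<forall>\<^sub>F x::real in cofinite. poly r (of_real x) \<in> \<real> \<and> 0 \<le> Re (poly r (of_real x))"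
  shows "poly r (of_real x) \<in> \<real> \<and> 0 \<le> Re (poly r (of_real x))"
proof -
  have ev: "\<forall>\<^sub>F x::real in cofinite. 0 \<le> Re (poly r (of_real x))"
    "\<forall>\<^sub>F x::real in cofinite. 0 \<le> Im (poly r (of_real x))"
    "\<forall>\<^sub>F x::real in cofinite. Im (poly r (of_real x)) \<le> 0"
    using assms by (auto elim!: eventually_mono simp: complex_is_Real_iff)
  have "0 \<le> Re (poly r (of_real x))" "0 \<le> Im (poly r (of_real x))" "Im (poly r (of_real x)) \<le> 0"
    using continuous_le_if_cofinite[OF ev(1)] continuous_le_if_cofinite[OF ev(2)]
      continuous_le_if_cofinite[OF ev(3)] by (simp_all add: isCont_poly_of_real)
  then show ?thesis by (simp add: complex_is_Real_iff)
qed

text \<open>The Fejer--Riesz factorization on the real line: nonreal roots come in conjugate pairs,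
  real roots have even order because of the sign.\<close>

lemma fejer_riesz_poly:
  fixes r :: "complex poly"
  assumes "\<And>x::real. poly r (of_real x) \<in> \<real> \<and> 0 \<le> Re (poly r (of_real x))"
  shows "\<exists>b. \<forall>x::real. poly r (of_real x) = poly b (of_real x) * cnj (poly b (of_real x))"
  using assms
proof (induction "degree r" arbitrary: r rule: less_induct)
  case less
  note nn = less.prems
  show ?case
  proof (cases "degree r = 0")
    case True
    then obtain c where r: "r = [:c:]" by (metis degree_eq_zeroE)
    have c: "c \<in> \<real>" "0 \<le> Re c" using nn[of 0] by (auto simp: r)
    then have "c = of_real (Re c)" by (simp add: complex_eq_iff complex_is_Real_iff)
    also have "\<dots> = of_real (sqrt (Re c)) * cnj (of_real (sqrt (Re c)))"
      using c(2) by (simp flip: of_real_mult)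
    finally show ?thesis by (intro exI[of _ "[:of_real (sqrt (Re c)):]"]) (simp add: r)
  next
    case False
    then obtain \<alpha> where \<alpha>: "poly r \<alpha> = 0"
      using fundamental_theorem_of_algebra constant_degree by metis
    have r0: "r \<noteq> 0" using False by auto
    have lin_dvd: "[:-\<alpha>, 1:] dvd r" using \<alpha> by (simp add: poly_eq_0_iff_dvd)
    then obtain s where s: "r = [:-\<alpha>, 1:] * s" by (elim dvdE)
    \<comment> \<open>The factor to split off is (x - \<alpha>)(x - cnj \<alpha>), which equals |x -
      \<alpha>|^2 on the real line. For real \<alpha> this asks for a double root: \<open>s\<close>
      is nonnegative to the right and nonpositive to the left of \<alpha>, so it vanishes there by
      continuity.\<close>
    have "poly s (cnj \<alpha>) = 0"
    proof (cases "\<alpha> \<in> \<real>")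
      case False
      have "\<forall>\<^sub>F x::real in cofinite. poly (map_poly cnj r) (of_real x) = poly r (of_real x)"
        using nn by (intro always_eventually) (simp add: Reals_cnj_iff)
      then have "map_poly cnj r = r" by (rule poly_eq_if_cofinite_real)
      then have "poly r (cnj \<alpha>) = 0" using \<alpha> by (metis complex_cnj_zero poly_cnj)
      moreover have "cnj \<alpha> - \<alpha> \<noteq> 0" using False by (simp add: Reals_cnj_iff)
      ultimately show ?thesis by (simp add: s)
    next
      case True
      then obtain a where a: "\<alpha> = of_real a" by (auto elim: Reals_cases)
      have val: "poly r (of_real x) = of_real (x - a) * poly s (of_real x)" for x
        by (simp add: s a algebra_simps)
      have sr: "poly s (of_real x) \<in> \<real>" if "x \<noteq> a" for x
      proof -
        have "poly s (of_real x) = poly r (of_real x) / of_real (x - a)" using that by (simp add: val)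
        then show ?thesis using nn[of x] by (metis Reals_divide Reals_of_real)
      qed
      have cont: "isCont (\<lambda>x::real. Im (poly s (of_real x))) a" "isCont (\<lambda>x::real. Re (poly s (of_real x))) a"
        by (simp_all add: isCont_poly_of_real)
      have cof: "\<forall>\<^sub>F x in cofinite. x \<noteq> a" by (simp add: eventually_cofinite)
      have "\<forall>\<^sub>F x in cofinite. Im (poly s (of_real x)) \<le> 0" "\<forall>\<^sub>F x in cofinite. 0 \<le> Im (poly s (of_real x))"
        using sr by (auto intro!: eventually_mono[OF cof] simp: complex_is_Real_iff)
      from continuous_le_if_cofinite[OF this(1) cont(1)] continuous_le_if_cofinite[OF this(2) _ cont(1)]
      have im: "Im (poly s (of_real a)) = 0" by simp
      have sgn: "0 \<le> (x - a) * Re (poly s (of_real x))" for x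
        using nn[of x] by (simp add: val)
      have sgn_right: "0 \<le> Re (poly s (of_real x))" if "a < x" for x
        using sgn[of x] that by (auto simp: zero_le_mult_iff)
      have sgn_left: "Re (poly s (of_real x)) \<le> 0" if "x < a" for x
        using sgn[of x] that by (auto simp: zero_le_mult_iff)
      have re: "((\<lambda>x. Re (poly s (of_real x))) \<longlongrightarrow> Re (poly s (of_real a))) (at a)"
        using cont(2) by (simp add: isCont_def)
      have "Re (poly s (of_real a)) \<ge> 0"
      proof (rule tendsto_lowerbound[where F = "at_right a"])
        show "((\<lambda>x. Re (poly s (of_real x))) \<longlongrightarrow> Re (poly s (of_real a))) (at_right a)"
          using re by (rule filterlim_mono) (auto simp: at_le)
        show "\<forall>\<^sub>F x in at_right a. 0 \<le> Re (poly s (of_real x))"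
          unfolding eventually_at_filter using sgn_right
          by (intro always_eventually) auto
      qed simp
      moreover have "Re (poly s (of_real a)) \<le> 0"
      proof (rule tendsto_upperbound[where F = "at_left a"])
        show "((\<lambda>x. Re (poly s (of_real x))) \<longlongrightarrow> Re (poly s (of_real a))) (at_left a)"
          using re by (rule filterlim_mono) (auto simp: at_le)
        show "\<forall>\<^sub>F x in at_left a. Re (poly s (of_real x)) \<le> 0"
          unfolding eventually_at_filter using sgn_left
          by (intro always_eventually) auto
      qed simp
      ultimately show ?thesis using im by (simp add: a complex_eq_iff)
    qed
    then have "[:-cnj \<alpha>, 1:] dvd s" by (simp add: poly_eq_0_iff_dvd)
    then obtain u where u: "s = [:-cnj \<alpha>, 1:] * u" by (elim dvdE)
    have ru: "r = ([:-\<alpha>, 1:] * [:-cnj \<alpha>, 1:]) * u" by (simp only: s u mult.assoc)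
    have u0: "u \<noteq> 0" using r0 ru by auto
    have deg: "degree u < degree r"
      unfolding ru using u0 by (subst degree_mult_eq) (auto simp: degree_mult_eq)
    have val: "poly r (of_real x) = of_real ((cmod (of_real x - \<alpha>))\<^sup>2) * poly u (of_real x)" for x :: real
      unfolding ru by (simp only: complex_norm_square) (simp add: algebra_simps)
    have "poly u (of_real x) \<in> \<real> \<and> 0 \<le> Re (poly u (of_real x))" for x :: real
    proof -
      have c: "poly u (of_real x) \<in> \<real> \<and> 0 \<le> Re (poly u (of_real x))" if "of_real x \<noteq> \<alpha>" for x :: real
      proof -
        define m where "m = (cmod (of_real x - \<alpha>))\<^sup>2"
        have m: "m > 0" using that by (simp add: m_def)
        have "poly u (of_real x) = poly r (of_real x) / of_real m" using m val[of x] by (simp add: m_def)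
        then show ?thesis using nn[of x] m by (auto intro!: Reals_divide)
      qed
      have cof: "\<forall>\<^sub>F x in cofinite. complex_of_real x \<noteq> \<alpha>"
        using eventually_cofinite_poly_neq_0[of "[:-\<alpha>, 1:]"] by simp
      show ?thesis
        by (rule poly_nonneg_real_if_cofinite) (use c in \<open>auto intro!: eventually_mono[OF cof]\<close>)
    qed
    from less.hyps[OF deg this] obtain b
      where b: "\<And>x::real. poly u (of_real x) = poly b (of_real x) * cnj (poly b (of_real x))" by blast
    have "poly r (of_real x) = poly ([:-\<alpha>, 1:] * b) (of_real x) * cnj (poly ([:-\<alpha>, 1:] * b) (of_real x))" for x :: real
      unfolding ru by (simp add: b algebra_simps)
    then show ?thesis by blast
  qed
qed

text \<open>Multiplying \<open>f = h / d\<close> by |d|^2 gives the polynomial \<open>r\<close>,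
  nonnegative on the line; its Fejer--Riesz factor is then divided by \<open>d\<close>.\<close>

lemma fejer_riesz_ratf:
  assumes "ratf f" and nn: "\<forall>\<^sub>F x in cofinite. f x \<in> \<real> \<and> 0 \<le> Re (f x)"
  shows "\<exists>b. ratf b \<and> (\<forall>\<^sub>F x in cofinite. f x = b x * cnj (b x))"
proof -
  obtain d h where d: "d \<noteq> 0" and e: "\<forall>\<^sub>F x in cofinite. poly d (of_real x) * f x = poly h (of_real x)"
    using assms(1) unfolding ratf_def by blast
  define r where "r = h * map_poly cnj d"
  have r: "\<forall>\<^sub>F x in cofinite. poly r (of_real x) = of_real ((cmod (poly d (of_real x)))\<^sup>2) * f x"
    using e
  proof eventually_elim
    case (elim x)
    have "of_real ((cmod (poly d (of_real x)))\<^sup>2) = poly d (of_real x) * cnj (poly d (of_real x))"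
      by (simp only: complex_norm_square)
    then show ?case unfolding r_def by (simp add: elim[symmetric] mult_ac del: of_real_power)
  qed
  have ev: "\<forall>\<^sub>F x in cofinite. poly r (of_real x) \<in> \<real> \<and> 0 \<le> Re (poly r (of_real x))"
    using r nn by eventually_elim (auto simp: complex_is_Real_iff)
  have "poly r (of_real x) \<in> \<real> \<and> 0 \<le> Re (poly r (of_real x))" for x :: real
    by (rule poly_nonneg_real_if_cofinite[OF ev])
  from fejer_riesz_poly[OF this] obtain b
    where b: "\<And>x::real. poly r (of_real x) = poly b (of_real x) * cnj (poly b (of_real x))" by blast
  have "\<forall>\<^sub>F x in cofinite. f x = (poly b (of_real x) / poly d (of_real x)) * cnj (poly b (of_real x) / poly d (of_real x))"
    using r eventually_cofinite_poly_neq_0[OF d]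
  proof eventually_elim
    case (elim x)
    have "f x * (poly d (of_real x) * cnj (poly d (of_real x))) = poly b (of_real x) * cnj (poly b (of_real x))"
      using elim(1) b[of x] unfolding complex_norm_square by (simp add: mult_ac)
    then show ?case using elim(2) by (simp add: field_simps)
  qed
  then show ?thesis by (intro exI[of _ "\<lambda>x. poly b (of_real x) / poly d (of_real x)"]) auto
qed

section \<open>Bezout kernels\<close>

text \<open>The Hermitian Bezout kernel \<open>(q z * cnj (r w) - r z * cnj (q w)) / (z - cnj w)\<close> is a sum of
  squares.\<close>

definition psd_pair :: "complex poly \<Rightarrow> complex poly \<Rightarrow> bool" where
  "psd_pair q r \<longleftrightarrow> (\<exists>m f. (\<forall>i<m. degree (f i) < degree q) \<and>
     (\<forall>z w. poly q z * cnj (poly r w) - poly r z * cnj (poly q w) =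
        (z - cnj w) * (\<Sum>i<(m::nat). poly (f i) z * cnj (poly (f i) w))))"

text \<open>For fixed \<open>w\<close> both sides of the kernel identity are polynomials in
  \<open>z\<close>, and comparing the coefficients of z^(n+1) recovers \<open>r\<close> from the
  \<open>f i\<close>. The leading coefficient of \<open>r\<close> thus becomes a sum of squares,
  which is where the sign of \<beta> comes from.\<close>

lemma bezout_kernel_lead_coeffs:
  fixes q r :: "complex poly" and f :: "nat \<Rightarrow> complex poly"
  assumes q: "degree q = Suc n" "coeff q (Suc n) = 1" and r: "degree r \<le> n"
    and f: "\<And>i. i < m \<Longrightarrow> degree (f i) \<le> n"
    and ker: "\<And>z w. poly q z * cnj (poly r w) - poly r z * cnj (poly q w) =
        (z - cnj w) * (\<Sum>i<m. poly (f i) z * cnj (poly (f i) w))"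
  shows "r = (\<Sum>i<m. smult (cnj (coeff (f i) n)) (f i))"
    and "coeff r n = of_real (\<Sum>i<m. (cmod (coeff (f i) n))\<^sup>2)"
proof -
  have val: "cnj (poly r w) = (\<Sum>i<m. coeff (f i) n * cnj (poly (f i) w))" for w
  proof -
    define F where "F = (\<Sum>i<m. smult (cnj (poly (f i) w)) (f i))"
    have eq: "smult (cnj (poly r w)) q - smult (cnj (poly q w)) r = [:- cnj w, 1:] * F"
    proof (rule iffD1[OF poly_eq_poly_eq_iff, OF ext])
      fix z
      show "poly (smult (cnj (poly r w)) q - smult (cnj (poly q w)) r) z = poly ([:- cnj w, 1:] * F) z"
        using ker[of z w]
        by (simp add: F_def poly_sum mult_ac) (simp add: algebra_simps)
    qed
    have "degree F \<le> n" unfolding F_def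
      by (intro degree_sum_le) (auto intro: order.trans[OF degree_smult_le] f)
    then have "coeff F (Suc n) = 0" by (simp add: coeff_eq_0)
    moreover have "coeff r (Suc n) = 0" using r by (simp add: coeff_eq_0)
    moreover have "coeff ([:- cnj w, 1:] * F) (Suc n) = - cnj w * coeff F (Suc n) + coeff F n"
      by simp
    ultimately have "coeff F n = cnj (poly r w)"
      using arg_cong[OF eq, of "\<lambda>p. coeff p (Suc n)"] q by simp
    then show ?thesis by (simp add: F_def coeff_sum mult_ac)
  qed
  show r_eq: "r = (\<Sum>i<m. smult (cnj (coeff (f i) n)) (f i))"
  proof (rule iffD1[OF poly_eq_poly_eq_iff, OF ext])
    fix w
    have "poly r w = cnj (cnj (poly r w))" by simp
    also have "\<dots> = poly (\<Sum>i<m. smult (cnj (coeff (f i) n)) (f i)) w"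
      unfolding val by (simp add: poly_sum)
    finally show "poly r w = poly (\<Sum>i<m. smult (cnj (coeff (f i) n)) (f i)) w" .
  qed
  have "coeff r n = (\<Sum>i<m. coeff (f i) n * cnj (coeff (f i) n))"
    by (subst r_eq) (simp add: coeff_sum mult_ac)
  then show "coeff r n = of_real (\<Sum>i<m. (cmod (coeff (f i) n))\<^sup>2)"
    by (simp only: of_real_sum complex_norm_square)
qed

text \<open>One division step. The number \<open>a\<close> cancels the coefficient of t^(n+1) in
  \<open>r\<close>. The kernel of (\<open>q1\<close>, \<open>r\<close>) is that of
  (\<open>q\<close>, \<open>q1\<close>) minus the rank-one kernel q1(z) cnj (q1(w)), and it is still
  a sum of squares because this subtraction is an orthogonal projection.\<close>

lemma psd_pair_step:
  fixes q q1 :: "complex poly"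
  assumes q: "degree q = Suc (Suc n)" "coeff q (Suc (Suc n)) = 1"
    and q1: "degree q1 = Suc n" "coeff q1 (Suc n) = 1"
    and psd: "psd_pair q q1"
    and a: "a = coeff q1 n - coeff q (Suc n)" "a \<in> \<real>"
    and r: "r = [:-a, 1:] * q1 - q" and b: "\<beta> = coeff r n"
  shows "\<beta> \<in> \<real>" "0 \<le> Re \<beta>" "\<beta> = 0 \<Longrightarrow> r = 0"
    "\<beta> \<noteq> 0 \<Longrightarrow> degree (smult (1 / \<beta>) r) = n \<and> coeff (smult (1 / \<beta>) r) n = 1 \<and> psd_pair q1 (smult (1 / \<beta>) r)"
proof -
  obtain m :: nat and f where fd: "\<And>i. i < m \<Longrightarrow> degree (f i) < degree q"
    and ker: "\<And>z w. poly q z * cnj (poly q1 w) - poly q1 z * cnj (poly q w) =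
        (z - cnj w) * (\<Sum>i<m. poly (f i) z * cnj (poly (f i) w))"
    using psd unfolding psd_pair_def by blast
  have fd': "degree (f i) \<le> Suc n" if "i < m" for i using fd[OF that] q by simp
  define c where "c i = coeff (f i) (Suc n)" for i
  note ext = bezout_kernel_lead_coeffs[OF q _ fd' ker, folded c_def]
  have q1_eq: "q1 = (\<Sum>i<m. smult (cnj (c i)) (f i))" using q1 by (intro ext(1)) auto
  have cc: "(\<Sum>i<m. c i * cnj (c i)) = 1"
  proof -
    have "coeff q1 (Suc n) = of_real (\<Sum>i<m. (cmod (c i))\<^sup>2)" using q1 by (intro ext(2)) auto
    also have "\<dots> = (\<Sum>i<m. c i * cnj (c i))" by (simp only: of_real_sum complex_norm_square)
    finally show ?thesis using q1 by simp
  qed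
  \<comment> \<open>The vector \<open>c\<close> has norm 1 and \<open>q1\<close> is the inner
    product of the vector of all \<open>f i\<close> with \<open>c\<close>. Passing to
    \<open>g\<close> removes the component along \<open>c\<close>, so the kernel loses exactly q1(z)
    cnj (q1(w)).\<close>
  define g where "g i = f i - smult (c i) q1" for i
  have gd: "degree (g i) \<le> n" if "i < m" for i
  proof (rule degree_le, intro allI impI)
    fix k assume "n < k"
    then consider "k = Suc n" | "k > Suc n" by linarith
    then show "coeff (g i) k = 0"
      by cases (use q1 fd'[OF that] in \<open>auto simp: g_def c_def coeff_eq_0\<close>)
  qed
  have rd: "degree r \<le> n"
  proof (rule degree_le, intro allI impI)
    fix k assume "n < k"
    then consider "k = Suc n" | "k = Suc (Suc n)" | "k > Suc (Suc n)" by linarith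
    then show "coeff r k = 0"
      by cases (use q1 q in \<open>auto simp: r a(1) coeff_eq_0 coeff_pCons split: nat.split\<close>)
  qed
  have gg: "(\<Sum>i<m. poly (g i) z * cnj (poly (g i) w)) =
      (\<Sum>i<m. poly (f i) z * cnj (poly (f i) w)) - poly q1 z * cnj (poly q1 w)" for z w
  proof -
    have q1v: "poly q1 z = (\<Sum>i<m. cnj (c i) * poly (f i) z)" for z
      by (subst q1_eq) (simp add: poly_sum)
    have "(\<Sum>i<m. poly (g i) z * cnj (poly (g i) w)) =
        (\<Sum>i<m. poly (f i) z * cnj (poly (f i) w)) - (\<Sum>i<m. cnj (c i) * poly (f i) z) * cnj (poly q1 w)
        - poly q1 z * cnj (\<Sum>i<m. cnj (c i) * poly (f i) w) + (\<Sum>i<m. c i * cnj (c i)) * (poly q1 z * cnj (poly q1 w))"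
      by (simp add: g_def algebra_simps sum.distrib sum_subtractf sum_distrib_left sum_distrib_right)
    then show ?thesis by (simp add: cc flip: q1v)
  qed
  have ker1: "poly q1 z * cnj (poly r w) - poly r z * cnj (poly q1 w) =
      (z - cnj w) * (\<Sum>i<m. poly (g i) z * cnj (poly (g i) w))" for z w
  proof -
    have ca: "cnj a = a" using a(2) by (simp add: Reals_cnj_iff)
    have "poly q1 z * cnj (poly r w) - poly r z * cnj (poly q1 w)
        = (poly q z * cnj (poly q1 w) - poly q1 z * cnj (poly q w)) - (z - cnj w) * (poly q1 z * cnj (poly q1 w))"
      by (simp add: r ca algebra_simps)
    then show ?thesis unfolding gg ker by (simp add: algebra_simps)
  qed
  note ext1 = bezout_kernel_lead_coeffs[OF q1 rd gd ker1]
  define s where "s = (\<Sum>i<m. (cmod (coeff (g i) n))\<^sup>2)"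
  have \<beta>: "\<beta> = of_real s" unfolding b s_def by (rule ext1(2))
  have s0: "0 \<le> s" unfolding s_def by (simp add: sum_nonneg)
  show "\<beta> \<in> \<real>" "0 \<le> Re \<beta>" using \<beta> s0 by auto
  \<comment> \<open>As \<beta> is the sum of the |coeff (g i) n|^2, all these coefficients vanish,
    and \<open>r\<close> is a combination of the \<open>g i\<close> with their conjugates as
    weights.\<close>
  show "r = 0" if "\<beta> = 0"
  proof -
    have "s = 0" using that \<beta> by simp
    then have "\<And>i. i < m \<Longrightarrow> coeff (g i) n = 0" unfolding s_def by (subst (asm) sum_nonneg_eq_0_iff) auto
    then have "(\<Sum>i<m. smult (cnj (coeff (g i) n)) (g i)) = 0" by simp
    then show ?thesis using ext1(1) by simp
  qed
  assume n0: "\<beta> \<noteq> 0"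
  then have sp: "s > 0" using \<beta> s0 by auto
  have co: "coeff (smult (1 / \<beta>) r) n = 1" using n0 b by simp
  have dg: "degree (smult (1 / \<beta>) r) = n"
    using rd n0 b by (simp add: le_antisym le_degree)
  \<comment> \<open>Dividing \<open>r\<close> by \<beta> = s > 0 divides the kernel by
    \<open>s\<close>, which is absorbed into the squares.\<close>
  define h where "h i = smult (of_real (1 / sqrt s)) (g i)" for i
  have sq: "complex_of_real (1 / sqrt s) * complex_of_real (1 / sqrt s) = 1 / \<beta>"
    using sp \<beta> by (simp flip: of_real_mult)
  have "psd_pair q1 (smult (1 / \<beta>) r)" unfolding psd_pair_def
  proof (intro exI conjI allI impI)
    fix i assume "i < m"
    then show "degree (h i) < degree q1" using gd[of i] q1 by (simp add: h_def)
  next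
    fix z w
    have "(\<Sum>i<m. poly (h i) z * cnj (poly (h i) w)) =
      (\<Sum>i<m. (complex_of_real (1 / sqrt s) * complex_of_real (1 / sqrt s)) * (poly (g i) z * cnj (poly (g i) w)))"
      by (rule sum.cong) (simp_all add: h_def mult_ac)
    also have "\<dots> = (1 / \<beta>) * (\<Sum>i<m. poly (g i) z * cnj (poly (g i) w))"
      by (simp only: sq sum_distrib_left)
    finally have hh: "(\<Sum>i<m. poly (h i) z * cnj (poly (h i) w)) = (1 / \<beta>) * (\<Sum>i<m. poly (g i) z * cnj (poly (g i) w))" .
    have "cnj \<beta> = \<beta>" using \<beta> by simp
    then have "poly q1 z * cnj (poly (smult (1 / \<beta>) r) w) - poly (smult (1 / \<beta>) r) z * cnj (poly q1 w)
      = (1 / \<beta>) * (poly q1 z * cnj (poly r w) - poly r z * cnj (poly q1 w))"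
      by (simp add: algebra_simps)
    then show "poly q1 z * cnj (poly (smult (1 / \<beta>) r) w) - poly (smult (1 / \<beta>) r) z * cnj (poly q1 w)
      = (z - cnj w) * (\<Sum>i<m. poly (h i) z * cnj (poly (h i) w))"
      unfolding hh ker1 by simp
  qed
  then show "degree (smult (1 / \<beta>) r) = n \<and> coeff (smult (1 / \<beta>) r) n = 1 \<and> psd_pair q1 (smult (1 / \<beta>) r)"
    using co dg by blast
qed

text \<open>At a nonreal root \<open>z\<close> of \<open>q1\<close> the kernel vanishes at (z, z),
  so every \<open>f i\<close> vanishes at \<open>z\<close>. Then the kernel vanishes at (z, w) for
  all \<open>w\<close>, which forces q(z) cnj (q1(w)) = 0 although neither \<open>q z\<close> nor
  \<open>q1\<close> is zero.\<close>

lemma psd_pair_real_roots: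
  assumes psd: "psd_pair q q1" and q: "q \<noteq> 0" and q1: "q1 \<noteq> 0"
    and roots: "\<And>z. poly q z = 0 \<Longrightarrow> z \<in> \<real>" and z: "poly q1 z = 0"
  shows "z \<in> \<real>"
proof (rule ccontr)
  assume nr: "z \<notin> \<real>"
  obtain m :: nat and f where
    ker: "\<And>z w. poly q z * cnj (poly q1 w) - poly q1 z * cnj (poly q w) =
        (z - cnj w) * (\<Sum>i<m. poly (f i) z * cnj (poly (f i) w))"
    using psd unfolding psd_pair_def by blast
  have "z - cnj z \<noteq> 0" using nr by (simp add: Reals_cnj_iff)
  then have "(\<Sum>i<m. poly (f i) z * cnj (poly (f i) z)) = 0" using ker[of z z] z by simp
  then have "of_real (\<Sum>i<m. (cmod (poly (f i) z))\<^sup>2) = (0 :: complex)"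
    by (simp only: of_real_sum complex_norm_square)
  then have "(\<Sum>i<m. (cmod (poly (f i) z))\<^sup>2) = 0" by (simp only: of_real_eq_0_iff)
  then have f0: "poly (f i) z = 0" if "i < m" for i
    using that by (subst (asm) sum_nonneg_eq_0_iff) auto
  have "poly q z * cnj (poly q1 w) = 0" for w
    using ker[of z w] z f0 by simp
  moreover have "poly q z \<noteq> 0" using roots nr by blast
  ultimately have "poly q1 w = 0" for w by simp
  then have "q1 = 0" using poly_all_0_iff_0 by blast
  then show False using q1 by simp
qed

section \<open>Monic polynomials with only real roots\<close>

lemma real_roots_decompose:
  assumes "degree (q :: complex poly) = n" "coeff q n = 1" "\<And>z. poly q z = 0 \<Longrightarrow> z \<in> \<real>"
  obtains l :: "nat \<Rightarrow> real" where "q = (\<Prod>i<n. [:- of_real (l i), 1:])"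
proof -
  obtain root where root: "smult (lead_coeff q) (\<Prod>i<degree q. [:-root i, 1:]) = q"
    by (rule complex_poly_decompose')
  then have q: "q = (\<Prod>i<n. [:-root i, 1:])" using assms by simp
  have "root i \<in> \<real>" if "i < n" for i
    using that by (intro assms(3)) (auto simp: q poly_prod)
  then have "root i = of_real (Re (root i))" if "i < n" for i using that by simp
  then have "q = (\<Prod>i<n. [:- of_real (Re (root i)), 1:])"
    unfolding q by (intro prod.cong) auto
  then show ?thesis by (rule that)
qed

lemma real_roots_coeff:
  assumes "degree (q :: complex poly) = n" "coeff q n = 1" "\<And>z. poly q z = 0 \<Longrightarrow> z \<in> \<real>"
  shows "coeff q k \<in> \<real>"
proof -
  obtain l :: "nat \<Rightarrow> real" where q: "q = (\<Prod>i<n. [:- of_real (l i), 1:])"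
    using real_roots_decompose[OF assms] by blast
  have "\<forall>k. coeff (\<Prod>i<m. [:- of_real (l i) :: complex, 1:]) k \<in> \<real>" for m
  proof (induction m)
    case 0
    show ?case by (simp add: coeff_1)
  next
    case (Suc m)
    then show ?case by (auto simp: coeff_pCons split: nat.split intro!: Reals_diff Reals_mult)
  qed
  then show ?thesis by (simp add: q)
qed

text \<open>Both the start and the restart of Euclid's algorithm rest on this. The derivative is the
  sum of the products \<open>g i\<close> that omit one linear factor. Since q(z) = (z - l i) g_i(z)
  with \<open>l i\<close> real, the kernel of (\<open>q\<close>, \<open>g i\<close>) is the single
  square g_i(z) cnj (g_i(w)).\<close>

lemma psd_pair_pderiv:
  assumes q: "degree (q :: complex poly) = Suc n" "coeff q (Suc n) = 1" "\<And>z. poly q z = 0 \<Longrightarrow> z \<in> \<real>"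
  defines "q1 \<equiv> smult (1 / of_nat (Suc n)) (pderiv q)"
  shows "degree q1 = n" "coeff q1 n = 1" "psd_pair q q1"
proof -
  show "degree q1 = n" unfolding q1_def using q by (simp add: degree_pderiv del: of_nat_Suc)
  show "coeff q1 n = 1" unfolding q1_def using q(2) by (simp add: coeff_pderiv del: of_nat_Suc)
  obtain l :: "nat \<Rightarrow> real" where ql: "q = (\<Prod>i<Suc n. [:- of_real (l i), 1:])"
    using real_roots_decompose[OF q] by blast
  define g where "g i = (\<Prod>j\<in>{..<Suc n} - {i}. [:- complex_of_real (l j), 1:])" for i
  have pd: "pderiv q = (\<Sum>i<Suc n. g i)" unfolding ql pderiv_prod g_def
    by (rule sum.cong) (simp_all add: pderiv_pCons)
  have qg: "poly q z = (z - of_real (l i)) * poly (g i) z" if "i < Suc n" for i z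
  proof -
    have "q = [:- complex_of_real (l i), 1:] * g i"
      unfolding ql g_def using that by (intro prod.remove) auto
    then have "poly q z = poly ([:- complex_of_real (l i), 1:] * g i) z" by (rule arg_cong)
    then show ?thesis by (simp add: algebra_simps)
  qed
  define c where "c = complex_of_real (1 / sqrt (real (Suc n)))"
  have cc: "c * cnj c = 1 / of_nat (Suc n)" unfolding c_def
    by (simp del: of_nat_Suc flip: of_real_mult)
  show "psd_pair q q1" unfolding psd_pair_def
  proof (intro exI conjI allI impI)
    fix i assume "i < Suc n"
    then have "degree (g i) \<le> n" unfolding g_def
      by (subst degree_prod_eq_sum_degree) auto
    then show "degree (smult c (g i)) < degree q" using q(1) degree_smult_le[of c "g i"] by linarith
  next
    fix z w
    have "poly q z * cnj (poly (pderiv q) w) - poly (pderiv q) z * cnj (poly q w)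
      = (\<Sum>i<Suc n. poly q z * cnj (poly (g i) w) - poly (g i) z * cnj (poly q w))"
      unfolding pd by (simp add: poly_sum sum_distrib_left sum_distrib_right sum_subtractf del: sum.lessThan_Suc)
    also have "\<dots> = (\<Sum>i<Suc n. (z - cnj w) * (poly (g i) z * cnj (poly (g i) w)))"
      by (rule sum.cong) (simp_all add: qg algebra_simps)
    finally have k: "poly q z * cnj (poly (pderiv q) w) - poly (pderiv q) z * cnj (poly q w)
      = (z - cnj w) * (\<Sum>i<Suc n. poly (g i) z * cnj (poly (g i) w))"
      by (simp only: sum_distrib_left)
    have "(\<Sum>i<Suc n. poly (smult c (g i)) z * cnj (poly (smult c (g i)) w))
      = (\<Sum>i<Suc n. (c * cnj c) * (poly (g i) z * cnj (poly (g i) w)))"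
      by (rule sum.cong) (simp_all add: mult_ac)
    also have "\<dots> = (1 / of_nat (Suc n)) * (\<Sum>i<Suc n. poly (g i) z * cnj (poly (g i) w))"
      by (simp only: cc sum_distrib_left)
    finally have s: "(\<Sum>i<Suc n. poly (smult c (g i)) z * cnj (poly (smult c (g i)) w))
      = (1 / of_nat (Suc n)) * (\<Sum>i<Suc n. poly (g i) z * cnj (poly (g i) w))" .
    have "poly q z * cnj (poly q1 w) - poly q1 z * cnj (poly q w)
       = (1 / of_nat (Suc n)) * (poly q z * cnj (poly (pderiv q) w) - poly (pderiv q) z * cnj (poly q w))"
      unfolding q1_def by (simp add: algebra_simps del: of_nat_Suc)
    then show "poly q z * cnj (poly q1 w) - poly q1 z * cnj (poly q w) =
        (z - cnj w) * (\<Sum>i<Suc n. poly (smult c (g i)) z * cnj (poly (smult c (g i)) w))"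
      unfolding s k by (simp only: mult_ac)
  qed
qed

section \<open>Jacobi matrices\<close>

definition rat_mat :: "nat \<Rightarrow> (real \<Rightarrow> complex mat) \<Rightarrow> bool" where
  "rat_mat n M \<longleftrightarrow> (\<forall>x. M x \<in> carrier_mat n n) \<and> (\<forall>i<n. \<forall>j<n. ratf (\<lambda>x. M x $$ (i, j)))"

text \<open>The new row and column come first, so that \<open>mat_delete _ 0 0\<close> undoes the
  bordering. Repeated bordering of a 1 x 1 matrix gives a tridiagonal one.\<close>

definition bordered_mat :: "'a::zero \<Rightarrow> 'a \<Rightarrow> 'a \<Rightarrow> 'a mat \<Rightarrow> 'a mat" where
  "bordered_mat a b c M = mat (Suc (dim_row M)) (Suc (dim_col M)) (\<lambda>(i, j).
     if i = 0 then (if j = 0 then a else if j = 1 then b else 0)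
     else if j = 0 then (if i = 1 then c else 0) else M $$ (i - 1, j - 1))"

lemma bordered_mat_carrier [simp]:
  "M \<in> carrier_mat n n \<Longrightarrow> bordered_mat a b c M \<in> carrier_mat (Suc n) (Suc n)"
  by (simp add: bordered_mat_def)

lemma mat_delete_bordered_mat [simp]: "mat_delete (bordered_mat a b c M) 0 0 = M"
  by (rule eq_matI) (auto simp: mat_delete_def bordered_mat_def)

text \<open>Expand along the first row, then the minor of the entry (0, 1) along its first column,
  where only the top entry survives.\<close>

lemma det_tridiagonal_step:
  fixes T :: "'a::comm_ring_1 mat"
  assumes T: "T \<in> carrier_mat (Suc (Suc n)) (Suc (Suc n))"
    and row: "\<And>j. 2 \<le> j \<Longrightarrow> j < Suc (Suc n) \<Longrightarrow> T $$ (0, j) = 0"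
    and col: "\<And>i. 2 \<le> i \<Longrightarrow> i < Suc (Suc n) \<Longrightarrow> T $$ (i, 0) = 0"
  shows "det T = T $$ (0, 0) * det (mat_delete T 0 0)
     - T $$ (0, 1) * T $$ (1, 0) * det (mat_delete (mat_delete T 0 0) 0 0)"
proof -
  define D where "D = mat_delete T 0 1"
  have D: "D \<in> carrier_mat (Suc n) (Suc n)" unfolding D_def using T by (simp add: mat_delete_def)
  have "det D = (\<Sum>i<Suc n. D $$ (i, 0) * cofactor D i 0)"
    by (rule laplace_expansion_column[OF D]) simp
  also have "\<dots> = D $$ (0, 0) * cofactor D 0 0 + (\<Sum>i<n. D $$ (Suc i, 0) * cofactor D (Suc i) 0)"
    by (rule sum.lessThan_Suc_shift)
  also have "(\<Sum>i<n. D $$ (Suc i, 0) * cofactor D (Suc i) 0) = 0"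
    by (rule sum.neutral) (use T col in \<open>auto simp: D_def mat_delete_def\<close>)
  also have "D $$ (0, 0) = T $$ (1, 0)" using T by (simp add: D_def mat_delete_def)
  also have "cofactor D 0 0 = det (mat_delete (mat_delete T 0 0) 0 0)"
  proof -
    have "mat_delete D 0 0 = mat_delete (mat_delete T 0 0) 0 0"
      by (rule eq_matI) (use T in \<open>auto simp: D_def mat_delete_def\<close>)
    then show ?thesis by (simp add: cofactor_def)
  qed
  finally have detD: "det D = T $$ (1, 0) * det (mat_delete (mat_delete T 0 0) 0 0)" by simp
  have "det T = (\<Sum>j<Suc (Suc n). T $$ (0, j) * cofactor T 0 j)"
    by (rule laplace_expansion_row[OF T]) simp
  also have "\<dots> = T $$ (0, 0) * cofactor T 0 0 + (T $$ (0, 1) * cofactor T 0 1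
      + (\<Sum>j<n. T $$ (0, Suc (Suc j)) * cofactor T 0 (Suc (Suc j))))"
    by (simp only: sum.lessThan_Suc_shift One_nat_def)
  also have "(\<Sum>j<n. T $$ (0, Suc (Suc j)) * cofactor T 0 (Suc (Suc j))) = 0"
    by (rule sum.neutral) (use row in auto)
  also have "cofactor T 0 1 = - det D" by (simp add: cofactor_def D_def)
  also have "cofactor T 0 0 = det (mat_delete T 0 0)" by (simp add: cofactor_def)
  finally show ?thesis by (simp add: detD mult.assoc)
qed

lemma char_poly_matrix_index:
  assumes "A \<in> carrier_mat n n" "i < n" "j < n"
  shows "char_poly_matrix A $$ (i, j) = (if i = j then [:- (A $$ (i, j)), 1:] else [:- (A $$ (i, j)):])"
  using assms by (auto simp: char_poly_matrix_def)

lemma char_poly_matrix_mat_delete: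
  assumes A: "A \<in> carrier_mat (Suc n) (Suc n)"
  shows "char_poly_matrix (mat_delete A 0 0) = mat_delete (char_poly_matrix A) 0 0"
proof (rule eq_matI)
  have D: "mat_delete A 0 0 \<in> carrier_mat n n" using A by (simp add: mat_delete_def)
  have C: "char_poly_matrix A \<in> carrier_mat (Suc n) (Suc n)" using A by simp
  show "dim_row (char_poly_matrix (mat_delete A 0 0)) = dim_row (mat_delete (char_poly_matrix A) 0 0)"
    "dim_col (char_poly_matrix (mat_delete A 0 0)) = dim_col (mat_delete (char_poly_matrix A) 0 0)"
    using carrier_matD[OF char_poly_matrix_closed[OF D]] carrier_matD[OF C] by simp_all
  fix i j assume "i < dim_row (mat_delete (char_poly_matrix A) 0 0)" "j < dim_col (mat_delete (char_poly_matrix A) 0 0)"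
  then have ij: "i < n" "j < n" using C by (auto simp: mat_delete_def)
  show "char_poly_matrix (mat_delete A 0 0) $$ (i, j) = mat_delete (char_poly_matrix A) 0 0 $$ (i, j)"
    unfolding char_poly_matrix_index[OF D ij] using ij carrier_matD[OF A] carrier_matD[OF C]
    by (simp add: mat_delete_def char_poly_matrix_index[OF A])
qed

text \<open>The matrix counterpart of the recurrence q = (t - a) q1 - \<beta> q2, with \<beta> = b
  c.\<close>

lemma char_poly_bordered_mat:
  fixes M :: "'a::comm_ring_1 mat"
  assumes M: "M \<in> carrier_mat (Suc n) (Suc n)"
  shows "char_poly (bordered_mat a b c M) =
    [:- a, 1:] * char_poly M - smult (b * c) (char_poly (mat_delete M 0 0))"
proof -
  define A where "A = bordered_mat a b c M"
  have A: "A \<in> carrier_mat (Suc (Suc n)) (Suc (Suc n))" unfolding A_def using M by simp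
  have del: "mat_delete A 0 0 = M" by (simp add: A_def)
  have "char_poly A = char_poly_matrix A $$ (0, 0) * det (mat_delete (char_poly_matrix A) 0 0)
     - char_poly_matrix A $$ (0, 1) * char_poly_matrix A $$ (1, 0)
       * det (mat_delete (mat_delete (char_poly_matrix A) 0 0) 0 0)"
    unfolding char_poly_def using A M
    by (intro det_tridiagonal_step[where n = n])
       (auto simp: char_poly_matrix_index[OF A], auto simp: A_def bordered_mat_def)
  also have "\<dots> = [:- a, 1:] * char_poly M - [:- b:] * [:- c:] * char_poly (mat_delete M 0 0)"
    unfolding char_poly_matrix_mat_delete[OF A, symmetric] del
      char_poly_matrix_mat_delete[OF M, symmetric] char_poly_def[symmetric] char_poly_matrix_index[OF A]
    using M by (simp add: char_poly_matrix_index[OF A]) (simp add: A_def bordered_mat_def)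
  finally show ?thesis by (simp add: A_def mult.commute)
qed

lemma char_poly_carrier_0: "A \<in> carrier_mat 0 0 \<Longrightarrow> char_poly A = 1"
  by (simp add: char_poly_def char_poly_matrix_def)

lemma char_poly_mat_1: "char_poly (mat 1 1 (\<lambda>_. a)) = [:- a, 1:]"
proof -
  have "mat 1 1 (\<lambda>_. a) \<in> carrier_mat 1 1" "upper_triangular (mat 1 1 (\<lambda>_. a))" by auto
  from char_poly_upper_triangular[OF this] show ?thesis by (simp add: diag_mat_def)
qed

text \<open>The induction follows Euclid's algorithm: the matrix for the pair (\<open>q1\<close>,
  \<open>q2\<close>) is bordered by \<open>a\<close>, \<open>b\<close> and \<open>cnj b\<close>. The
  recurrence involves two earlier polynomials, hence the extra conclusion about
  \<open>mat_delete (M x) 0 0\<close>.\<close>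

lemma jacobi_matrix_exists:
  fixes q q1 :: "real \<Rightarrow> complex poly"
  assumes "\<And>k. ratf (\<lambda>x. coeff (q x) k)" "\<And>k. ratf (\<lambda>x. coeff (q1 x) k)"
    and "\<forall>\<^sub>F x in cofinite. degree (q x) = Suc n \<and> coeff (q x) (Suc n) = 1 \<and>
      (\<forall>z. poly (q x) z = 0 \<longrightarrow> z \<in> \<real>) \<and> degree (q1 x) = n \<and> coeff (q1 x) n = 1 \<and> psd_pair (q x) (q1 x)"
  shows "\<exists>M. rat_mat (Suc n) M \<and> (\<forall>\<^sub>F x in cofinite. hermitian_mat (M x) \<and>
      char_poly (M x) = q x \<and> char_poly (mat_delete (M x) 0 0) = q1 x)"
  using assms
proof (induction n arbitrary: q q1)
  case 0
  define M where "M x = mat 1 1 (\<lambda>_. - coeff (q x) 0)" for x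
  have M: "M x \<in> carrier_mat 1 1" for x by (simp add: M_def)
  have "rat_mat (Suc 0) M" unfolding rat_mat_def using "0.prems"(1)[of 0] by (auto simp: M_def)
  moreover have "\<forall>\<^sub>F x in cofinite. hermitian_mat (M x) \<and>
      char_poly (M x) = q x \<and> char_poly (mat_delete (M x) 0 0) = q1 x"
    using "0.prems"(3)
  proof eventually_elim
    case (elim x)
    have "coeff (q x) 0 \<in> \<real>" using elim by (intro real_roots_coeff[of "q x" 1]) auto
    then have "hermitian_mat (M x)"
      unfolding hermitian_mat_iff[OF M] by (simp add: M_def Reals_cnj_iff)
    moreover have "char_poly (M x) = q x"
      unfolding M_def char_poly_mat_1
      by (rule poly_eqI2) (use elim in \<open>auto simp: le_Suc_eq\<close>)
    moreover have "char_poly (mat_delete (M x) 0 0) = 1"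
      by (rule char_poly_carrier_0) (simp add: M_def mat_delete_def)
    moreover have "q1 x = 1"
      by (rule poly_eqI2) (use elim in auto)
    ultimately show ?case by simp
  qed
  ultimately show ?case by blast
next
  case (Suc n)
  define a where "a x = coeff (q1 x) n - coeff (q x) (Suc n)" for x
  define r where "r x = [:- a x, 1:] * q1 x - q x" for x
  define \<beta> where "\<beta> x = coeff (r x) n" for x
  have ra: "ratf a" unfolding a_def using Suc.prems by (intro ratf_diff)
  have rr: "ratf (\<lambda>x. coeff (r x) k)" for k
  proof -
    have "ratf (\<lambda>x. (- a x * coeff (q1 x) k + (if k = 0 then 0 else coeff (q1 x) (k - 1))) - coeff (q x) k)"
      using Suc.prems ra by (cases "k = 0") (auto intro!: ratf_diff ratf_add ratf_mult ratf_uminus)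
    moreover have "coeff (r x) k = (- a x * coeff (q1 x) k + (if k = 0 then 0 else coeff (q1 x) (k - 1))) - coeff (q x) k" for x
      by (cases k) (simp_all add: r_def)
    ultimately show ?thesis by simp
  qed
  have r\<beta>: "ratf \<beta>" unfolding \<beta>_def by (rule rr)
  have pt: "\<forall>\<^sub>F x in cofinite. a x \<in> \<real> \<and> \<beta> x \<in> \<real> \<and> 0 \<le> Re (\<beta> x) \<and> (\<beta> x = 0 \<longrightarrow> r x = 0) \<and>
     degree (q1 x) = Suc n \<and> coeff (q1 x) (Suc n) = 1 \<and> (\<forall>z. poly (q1 x) z = 0 \<longrightarrow> z \<in> \<real>) \<and>
     (\<beta> x \<noteq> 0 \<longrightarrow> degree (smult (1 / \<beta> x) (r x)) = n \<and> coeff (smult (1 / \<beta> x) (r x)) n = 1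
        \<and> psd_pair (q1 x) (smult (1 / \<beta> x) (r x)))"
    using Suc.prems(3)
  proof eventually_elim
    case (elim x)
    have "q x \<noteq> 0" "q1 x \<noteq> 0" using elim by auto
    then have roots: "\<forall>z. poly (q1 x) z = 0 \<longrightarrow> z \<in> \<real>"
      using psd_pair_real_roots[of "q x" "q1 x"] elim by blast
    have "coeff (q1 x) n \<in> \<real>" using elim roots by (intro real_roots_coeff[of "q1 x" "Suc n"]) auto
    moreover have "coeff (q x) (Suc n) \<in> \<real>" using elim by (intro real_roots_coeff[of "q x" "Suc (Suc n)"]) auto
    ultimately have aR: "a x \<in> \<real>" unfolding a_def by (rule Reals_diff)
    show ?case
      using psd_pair_step[of "q x" n "q1 x" "a x" "r x" "\<beta> x"] elim roots aR
      by (simp add: a_def r_def \<beta>_def)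
  qed
  \<comment> \<open>If \<beta> vanishes almost everywhere, the recurrence leaves \<open>q2\<close>
    free, and the monic derivative of \<open>q1\<close> is a choice that keeps the pair a
    \<open>psd_pair\<close>. Otherwise \<open>q2\<close> is the remainder made monic.\<close>
  obtain q2 where q2: "\<And>k. ratf (\<lambda>x. coeff (q2 x) k)"
    and ev: "\<forall>\<^sub>F x in cofinite. r x = smult (\<beta> x) (q2 x) \<and> degree (q2 x) = n \<and> coeff (q2 x) n = 1 \<and> psd_pair (q1 x) (q2 x)"
  proof (cases "\<forall>\<^sub>F x in cofinite. \<beta> x = 0")
    case True
    define q2 where "q2 x = smult (1 / of_nat (Suc n)) (pderiv (q1 x))" for x
    have "ratf (\<lambda>x. coeff (q2 x) k)" for k
      unfolding q2_def coeff_smult coeff_pderiv using Suc.prems(2) by (intro ratf_mult ratf_const)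
    moreover have "\<forall>\<^sub>F x in cofinite. r x = smult (\<beta> x) (q2 x) \<and> degree (q2 x) = n \<and> coeff (q2 x) n = 1 \<and> psd_pair (q1 x) (q2 x)"
      using True pt
    proof eventually_elim
      case (elim x)
      then show ?case using psd_pair_pderiv[of "q1 x" n] by (simp add: q2_def del: of_nat_Suc)
    qed
    ultimately show ?thesis by (rule that)
  next
    case False
    then have nz: "\<forall>\<^sub>F x in cofinite. \<beta> x \<noteq> 0" using ratf_zero_or_neq_0[OF r\<beta>] by blast
    define q2 where "q2 x = smult (1 / \<beta> x) (r x)" for x
    have "ratf (\<lambda>x. coeff (q2 x) k)" for k
      unfolding q2_def coeff_smult using r\<beta> rr by (intro ratf_mult ratf_divide ratf_const)
    moreover have "\<forall>\<^sub>F x in cofinite. r x = smult (\<beta> x) (q2 x) \<and> degree (q2 x) = n \<and> coeff (q2 x) n = 1 \<and> psd_pair (q1 x) (q2 x)"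
      using nz pt by eventually_elim (auto simp: q2_def)
    ultimately show ?thesis by (rule that)
  qed
  have "\<exists>M. rat_mat (Suc n) M \<and> (\<forall>\<^sub>F x in cofinite. hermitian_mat (M x) \<and>
      char_poly (M x) = q1 x \<and> char_poly (mat_delete (M x) 0 0) = q2 x)"
    by (rule Suc.IH[OF Suc.prems(2) q2]) (use ev pt in \<open>eventually_elim, simp\<close>)
  then obtain M where M: "rat_mat (Suc n) M" and evM: "\<forall>\<^sub>F x in cofinite. hermitian_mat (M x) \<and>
      char_poly (M x) = q1 x \<and> char_poly (mat_delete (M x) 0 0) = q2 x" by blast
  have "\<forall>\<^sub>F x in cofinite. \<beta> x \<in> \<real> \<and> 0 \<le> Re (\<beta> x)" using pt by eventually_elim simp
  \<comment> \<open>A rational square root of \<beta> need not exist. Only the product of the two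
    off-diagonal entries enters the characteristic polynomial, so \<open>b\<close> and
    \<open>cnj b\<close> serve, at the price of complex entries.\<close>
  from fejer_riesz_ratf[OF r\<beta> this] obtain b where b: "ratf b" and
    evb: "\<forall>\<^sub>F x in cofinite. \<beta> x = b x * cnj (b x)" by blast
  define L where "L x = bordered_mat (a x) (b x) (cnj (b x)) (M x)" for x
  have Mc: "M x \<in> carrier_mat (Suc n) (Suc n)" for x using M by (simp add: rat_mat_def)
  have Lc: "L x \<in> carrier_mat (Suc (Suc n)) (Suc (Suc n))" for x unfolding L_def using Mc by simp
  have "ratf (\<lambda>x. L x $$ (i, j))" if ij: "i < Suc (Suc n)" "j < Suc (Suc n)" for i j
  proof -
    have L: "L x $$ (i, j) = (if i = 0 then (if j = 0 then a x else if j = 1 then b x else 0)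
      else if j = 0 then (if i = 1 then cnj (b x) else 0) else M x $$ (i - 1, j - 1))" for x
      using ij Mc[of x] by (simp add: L_def bordered_mat_def)
    have "ratf (\<lambda>x. M x $$ (i - 1, j - 1))" if "i \<noteq> 0" "j \<noteq> 0"
      using M ij that unfolding rat_mat_def by simp
    then show ?thesis unfolding L by (intro ratf_if ra b ratf_cnj[OF b] ratf_const)
  qed
  then have "rat_mat (Suc (Suc n)) L" unfolding rat_mat_def using Lc by blast
  moreover have "\<forall>\<^sub>F x in cofinite. hermitian_mat (L x) \<and>
      char_poly (L x) = q x \<and> char_poly (mat_delete (L x) 0 0) = q1 x"
    using pt ev evM evb
  proof eventually_elim
    case (elim x)
    have Mh: "M x $$ (i, j) = cnj (M x $$ (j, i))" if "i < Suc n" "j < Suc n" for i j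
      using elim that unfolding hermitian_mat_iff[OF Mc] by blast
    have "hermitian_mat (L x)"
      unfolding hermitian_mat_iff[OF Lc]
    proof (intro allI impI)
      fix i j assume ij: "i < Suc (Suc n)" "j < Suc (Suc n)"
      have "M x $$ (i - 1, j - 1) = cnj (M x $$ (j - 1, i - 1))" if "i \<noteq> 0" "j \<noteq> 0"
        using that ij by (intro Mh) auto
      moreover have "cnj (a x) = a x" using elim by (simp add: Reals_cnj_iff)
      ultimately show "L x $$ (i, j) = cnj (L x $$ (j, i))"
        using ij carrier_matD[OF Mc[of x]] by (simp add: L_def bordered_mat_def)
    qed
    moreover have "char_poly (L x) = q x"
      unfolding L_def char_poly_bordered_mat[OF Mc] using elim by (simp add: r_def algebra_simps)
    ultimately show ?case using elim by (simp add: L_def)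
  qed
  ultimately show ?case by blast
qed

corollary hermitian_rat_mat_exists:
  fixes q :: "real \<Rightarrow> complex poly"
  assumes "\<And>k. ratf (\<lambda>x. coeff (q x) k)" and n: "n > 0"
    and ev: "\<forall>\<^sub>F x in cofinite. degree (q x) = n \<and> coeff (q x) n = 1 \<and> (\<forall>z. poly (q x) z = 0 \<longrightarrow> z \<in> \<real>)"
  obtains M where "rat_mat n M" "\<forall>\<^sub>F x in cofinite. hermitian_mat (M x) \<and> char_poly (M x) = q x"
proof -
  obtain m where m: "n = Suc m" using n by (cases n) auto
  define q1 where "q1 x = smult (1 / of_nat (Suc m)) (pderiv (q x))" for x
  have r1: "ratf (\<lambda>x. coeff (q1 x) k)" for k
    unfolding q1_def coeff_smult coeff_pderiv using assms(1) by (intro ratf_mult ratf_const)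
  have "\<forall>\<^sub>F x in cofinite. degree (q x) = Suc m \<and> coeff (q x) (Suc m) = 1 \<and>
      (\<forall>z. poly (q x) z = 0 \<longrightarrow> z \<in> \<real>) \<and> degree (q1 x) = m \<and> coeff (q1 x) m = 1 \<and> psd_pair (q x) (q1 x)"
    using ev
  proof eventually_elim
    case (elim x)
    then show ?case using psd_pair_pderiv[of "q x" m] by (simp add: q1_def m del: of_nat_Suc)
  qed
  from jacobi_matrix_exists[OF assms(1) r1 this] obtain M where M: "rat_mat n M"
    and ev': "\<forall>\<^sub>F x in cofinite. hermitian_mat (M x) \<and> char_poly (M x) = q x \<and> char_poly (mat_delete (M x) 0 0) = q1 x"
    unfolding m by blast
  have "\<forall>\<^sub>F x in cofinite. hermitian_mat (M x) \<and> char_poly (M x) = q x"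
    using ev' by eventually_elim simp
  with M show ?thesis by (rule that)
qed

section \<open>Invariant lattices\<close>

text \<open>For \<open>k \<le> n\<close> this is A^k + c(n-1) A^(k-1) + ... + c(n-k), the leading
  coefficient being taken as 1.\<close>

primrec horner_mat :: "nat \<Rightarrow> (nat \<Rightarrow> 'a::comm_ring_1) \<Rightarrow> 'a mat \<Rightarrow> nat \<Rightarrow> 'a mat" where
  "horner_mat n c A 0 = 1\<^sub>m n"
| "horner_mat n c A (Suc k) = A * horner_mat n c A k + c (n - Suc k) \<cdot>\<^sub>m 1\<^sub>m n"

lemma horner_mat_carrier [simp]: "A \<in> carrier_mat n n \<Longrightarrow> horner_mat n c A k \<in> carrier_mat n n"
  by (induction k) auto

text \<open>The Cayley--Hamilton theorem: the coefficient matrices of the adjugate of \<open>X - A\<close> are the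
  Horner partial sums.\<close>

lemma cayley_hamilton_horner:
  fixes A :: "complex mat"
  assumes A: "A \<in> carrier_mat n n"
  shows "horner_mat n (coeff (char_poly A)) A n = 0\<^sub>m n n"
proof -
  define C where "C = char_poly_matrix A"
  define D where "D = adj_mat C"
  define \<chi> where "\<chi> = char_poly A"
  have C: "C \<in> carrier_mat n n" unfolding C_def using A by simp
  have D: "D \<in> carrier_mat n n" unfolding D_def by (rule adj_mat(1)[OF C])
  have CD: "C * D = \<chi> \<cdot>\<^sub>m 1\<^sub>m n" unfolding D_def adj_mat(2)[OF C] by (simp add: \<chi>_def C_def char_poly_def)
  \<comment> \<open>\<open>pCons 0\<close> shifts the index by one: \<open>B j\<close> holds the
    coefficients of t^(j-1) in the adjugate, and \<open>B 0\<close> is zero. So \<open>rel\<close>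
    compares the coefficients of t^j in (t - A) D = \<chi> for every j, including 0.\<close>
  define B where "B j = mat n n (\<lambda>(i, l). coeff (pCons 0 (D $$ (i, l))) j)" for j
  have B: "B j \<in> carrier_mat n n" for j by (simp add: B_def)
  have rel: "B j = A * B (Suc j) + coeff \<chi> j \<cdot>\<^sub>m 1\<^sub>m n" for j
  proof (rule eq_matI)
    fix i l assume "i < dim_row (A * B (Suc j) + coeff \<chi> j \<cdot>\<^sub>m 1\<^sub>m n)" "l < dim_col (A * B (Suc j) + coeff \<chi> j \<cdot>\<^sub>m 1\<^sub>m n)"
    then have il: "i < n" "l < n" using A B by auto
    have "(if i = l then \<chi> else 0) = (C * D) $$ (i, l)" unfolding CD using il by auto
    also have "\<dots> = (\<Sum>k<n. C $$ (i, k) * D $$ (k, l))"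
      using C D il by (simp add: scalar_prod_def atLeast0LessThan)
    also have "\<dots> = (\<Sum>k<n. (if k = i then pCons 0 (D $$ (i, l)) else 0) - smult (A $$ (i, k)) (D $$ (k, l)))"
      by (rule sum.cong) (use il in \<open>auto simp: C_def char_poly_matrix_index[OF A]\<close>)
    also have "\<dots> = pCons 0 (D $$ (i, l)) - (\<Sum>k<n. smult (A $$ (i, k)) (D $$ (k, l)))"
      using il by (simp add: sum_subtractf)
    finally have "coeff (pCons 0 (D $$ (i, l))) j
        = (\<Sum>k<n. A $$ (i, k) * coeff (D $$ (k, l)) j) + coeff (if i = l then \<chi> else 0) j"
      by (simp add: coeff_sum)
    then show "B j $$ (i, l) = (A * B (Suc j) + coeff \<chi> j \<cdot>\<^sub>m 1\<^sub>m n) $$ (i, l)"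
      using il A B[of "Suc j"]
      by (cases "i = l") (simp add: scalar_prod_def atLeast0LessThan, simp add: B_def)+
  qed (use A B in auto)
  have \<chi>: "degree \<chi> = n" "coeff \<chi> n = 1" using degree_monic_char_poly[OF A] by (auto simp: \<chi>_def)
  \<comment> \<open>\<open>J\<close> exceeds the degrees of all shifted entries, so
    \<open>B J\<close> vanishes. Going down with \<open>rel\<close>, where \<chi> has no
    coefficients above n, gives \<open>B (Suc n) = 0\<close> and hence
    \<open>B n = 1\<close>.\<close>
  define J where "J = Suc (n + (\<Sum>i<n. \<Sum>l<n. degree (pCons 0 (D $$ (i, l)))))"
  have BJ: "B J = 0\<^sub>m n n"
  proof (rule eq_matI)
    fix i l assume "i < dim_row (0\<^sub>m n n :: complex mat)" "l < dim_col (0\<^sub>m n n :: complex mat)"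
    then have il: "i < n" "l < n" by auto
    have "degree (pCons 0 (D $$ (i, l))) \<le> (\<Sum>l<n. degree (pCons 0 (D $$ (i, l))))"
      by (rule member_le_sum) (use il in auto)
    also have "\<dots> \<le> (\<Sum>i<n. \<Sum>l<n. degree (pCons 0 (D $$ (i, l))))"
      by (rule member_le_sum[of i _ "\<lambda>i. \<Sum>l<n. degree (pCons 0 (D $$ (i, l)))"]) (use il in auto)
    finally have "degree (pCons 0 (D $$ (i, l))) < J" unfolding J_def by simp
    then have "coeff (pCons 0 (D $$ (i, l))) J = 0" by (rule coeff_eq_0)
    then show "B J $$ (i, l) = 0\<^sub>m n n $$ (i, l)" using il by (simp add: B_def)
  qed (simp_all add: B_def)
  have "Suc n \<le> J" by (simp add: J_def)
  then have "B (Suc n) = 0\<^sub>m n n"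
  proof (induction rule: inc_induct)
    case base
    show ?case by (rule BJ)
  next
    case (step m)
    then have "coeff \<chi> m = 0" using \<chi> by (simp add: coeff_eq_0)
    then have "B m = A * B (Suc m) + 0 \<cdot>\<^sub>m 1\<^sub>m n" using rel[of m] by simp
    also have "A * B (Suc m) = 0\<^sub>m n n" unfolding step.IH using A by simp
    also have "0\<^sub>m n n + 0 \<cdot>\<^sub>m 1\<^sub>m n = (0\<^sub>m n n :: complex mat)" by (rule eq_matI) auto
    finally show ?case .
  qed
  moreover have "1 \<cdot>\<^sub>m 1\<^sub>m n = (1\<^sub>m n :: complex mat)" by (rule eq_matI) auto
  ultimately have Bn: "B n = 1\<^sub>m n" using rel[of n] A \<chi> by simp
  have "horner_mat n (coeff \<chi>) A k = B (n - k)" if "k \<le> n" for k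
    using that
  proof (induction k)
    case 0
    show ?case by (simp add: Bn)
  next
    case (Suc k)
    then show ?case using rel[of "n - Suc k"] by (simp add: Suc_diff_Suc)
  qed
  from this[of n] have "horner_mat n (coeff \<chi>) A n = B 0" by simp
  also have "B 0 = 0\<^sub>m n n" by (rule eq_matI) (auto simp: B_def)
  finally show ?thesis by (simp add: \<chi>_def)
qed

section \<open>Matrices with polynomial and rational entries\<close>

definition eval_mat :: "complex poly mat \<Rightarrow> complex \<Rightarrow> complex mat" where
  "eval_mat N z = map_mat (\<lambda>p. poly p z) N"

lemma eval_mat_carrier [simp]: "N \<in> carrier_mat n m \<Longrightarrow> eval_mat N z \<in> carrier_mat n m"
  by (simp add: eval_mat_def)

lemma eval_mat_index [simp]:
  "N \<in> carrier_mat n m \<Longrightarrow> i < n \<Longrightarrow> j < m \<Longrightarrow> eval_mat N z $$ (i, j) = poly (N $$ (i, j)) z"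
  by (simp add: eval_mat_def)

lemma comm_ring_hom_poly_eval: "comm_ring_hom (\<lambda>p. poly p (z :: 'a::comm_ring_1))"
  by unfold_locales auto

lemma det_eval_mat: "det (eval_mat N z) = poly (det N) z"
  unfolding eval_mat_def by (rule comm_ring_hom.hom_det[OF comm_ring_hom_poly_eval])

lemma rat_mat_const [intro]: "A \<in> carrier_mat n n \<Longrightarrow> rat_mat n (\<lambda>x. A)"
  by (simp add: rat_mat_def)

lemma rat_mat_add [intro]: 
  assumes "rat_mat n M" "rat_mat n N" shows "rat_mat n (\<lambda>x. M x + N x)"
proof -
  have c: "M x \<in> carrier_mat n n" "N x \<in> carrier_mat n n" for x using assms by (auto simp: rat_mat_def)
  have "ratf (\<lambda>x. M x $$ (i, j) + N x $$ (i, j))" if "i < n" "j < n" for i j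
    using assms that by (intro ratf_add) (auto simp: rat_mat_def)
  moreover have "(M x + N x) $$ (i, j) = M x $$ (i, j) + N x $$ (i, j)" if "i < n" "j < n" for i j x
    using that c[of x] by simp
  ultimately show ?thesis unfolding rat_mat_def using c by simp
qed

lemma rat_mat_smult [intro]:
  assumes "ratf f" "rat_mat n M" shows "rat_mat n (\<lambda>x. f x \<cdot>\<^sub>m M x)"
proof -
  have c: "M x \<in> carrier_mat n n" for x using assms by (auto simp: rat_mat_def)
  have "ratf (\<lambda>x. f x * M x $$ (i, j))" if "i < n" "j < n" for i j
    using assms that by (intro ratf_mult) (auto simp: rat_mat_def)
  moreover have "(f x \<cdot>\<^sub>m M x) $$ (i, j) = f x * M x $$ (i, j)" if "i < n" "j < n" for i j x
    using that c[of x] by simp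
  ultimately show ?thesis unfolding rat_mat_def using c by simp
qed

lemma index_mult_mat_sum:
  assumes "A \<in> carrier_mat n m" "B \<in> carrier_mat m l" "i < n" "j < l"
  shows "(A * B) $$ (i, j) = (\<Sum>k<m. A $$ (i, k) * B $$ (k, j))"
  using assms by (simp add: scalar_prod_def atLeast0LessThan)

lemma rat_mat_mult [intro]:
  assumes "rat_mat n M" "rat_mat n N" shows "rat_mat n (\<lambda>x. M x * N x)"
proof -
  have c: "M x \<in> carrier_mat n n" "N x \<in> carrier_mat n n" for x using assms by (auto simp: rat_mat_def)
  have "ratf (\<lambda>x. \<Sum>k<n. M x $$ (i, k) * N x $$ (k, j))" if "i < n" "j < n" for i j
    using assms that by (intro ratf_sum ratf_mult) (auto simp: rat_mat_def)
  then show ?thesis unfolding rat_mat_def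
    using mult_carrier_mat[OF c] by (simp add: index_mult_mat_sum[OF c] del: index_mult_mat)
qed

lemma rat_mat_horner:
  assumes "rat_mat n M" shows "rat_mat n (\<lambda>x. horner_mat n (\<lambda>k. poly (c k) (of_real x)) (M x) k)"
  by (induction k) (auto intro!: rat_mat_const rat_mat_add rat_mat_mult rat_mat_smult assms)

lemma rat_mat_common_denominator:
  assumes "rat_mat n M"
  obtains N d where "N \<in> carrier_mat n n" "d \<noteq> 0"
    "\<forall>\<^sub>F x::real in cofinite. eval_mat N (of_real x) = poly d (of_real x) \<cdot>\<^sub>m M x"
proof -
  have c: "M x \<in> carrier_mat n n" for x using assms by (auto simp: rat_mat_def)
  have "\<exists>d h. d \<noteq> 0 \<and> (\<forall>ij\<in>{..<n} \<times> {..<n}.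
      \<forall>\<^sub>F x in cofinite. poly d (of_real x) * M x $$ ij = poly (h ij) (of_real x))"
    by (rule ratf_common_denominator[where f = "\<lambda>ij x. M x $$ ij"])
       (use assms in \<open>auto simp: rat_mat_def\<close>)
  then obtain d h where d: "d \<noteq> 0"
    and h: "\<forall>ij\<in>{..<n} \<times> {..<n}. \<forall>\<^sub>F x in cofinite. poly d (of_real x) * M x $$ ij = poly (h ij) (of_real x)"
    by blast
  have "\<forall>\<^sub>F x in cofinite. \<forall>ij\<in>{..<n} \<times> {..<n}. poly d (of_real x) * M x $$ ij = poly (h ij) (of_real x)"
    by (intro eventually_ball_finite h) auto
  then have "\<forall>\<^sub>F x::real in cofinite. eval_mat (mat n n h) (of_real x) = poly d (of_real x) \<cdot>\<^sub>m M x"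
  proof eventually_elim
    case (elim x)
    show ?case by (rule eq_matI) (use elim c[of x] in \<open>auto simp: eval_mat_def\<close>)
  qed
  then show ?thesis by (intro that[OF _ d]) auto
qed

text \<open>The columns of all \<open>W j\<close> together span a lattice over the polynomials which \<open>M\<close> maps into
  itself.\<close>

definition stable_lattice :: "nat \<Rightarrow> (nat \<Rightarrow> complex poly) \<Rightarrow> (real \<Rightarrow> complex mat) \<Rightarrow> (nat \<Rightarrow> complex poly mat) \<Rightarrow> bool" where
  "stable_lattice n c M W \<longleftrightarrow> (\<forall>j\<le>n. W j \<in> carrier_mat n n) \<and> W 0 = 0\<^sub>m n n \<and> det (W n) \<noteq> 0 \<and>
     (\<forall>j<n. \<forall>\<^sub>F x::real in cofinite. M x * eval_mat (W (Suc j)) (of_real x) =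
        eval_mat (W j) (of_real x) - poly (c j) (of_real x) \<cdot>\<^sub>m eval_mat (W n) (of_real x))"

lemma mat_eq_0_if_cofinite:
  assumes N: "N \<in> carrier_mat n n" and "\<forall>\<^sub>F x::real in cofinite. eval_mat N (of_real x) = 0\<^sub>m n n"
  shows "N = 0\<^sub>m n n"
proof (rule eq_matI)
  fix i j assume "i < dim_row (0\<^sub>m n n :: complex poly mat)" "j < dim_col (0\<^sub>m n n :: complex poly mat)"
  then have ij: "i < n" "j < n" by auto
  have "\<forall>\<^sub>F x::real in cofinite. poly (N $$ (i, j)) (of_real x) = poly 0 (of_real x)"
    using assms(2)
  proof eventually_elim
    case (elim x)
    then have "eval_mat N (of_real x) $$ (i, j) = 0" using ij by simp
    then show ?case using N ij by simp
  qed
  then show "N $$ (i, j) = 0\<^sub>m n n $$ (i, j)" using ij by (simp add: poly_eq_if_cofinite_real)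
qed (use N in auto)

text \<open>With the Horner sums H_k of \<open>M\<close> and a common denominator \<open>d\<close>
  take W_j = d H_(n-j). The Horner recursion is the required relation, Cayley--Hamilton gives W_0 =
  0, and H_0 = 1 makes det (W n) = d^n nonzero.\<close>

lemma stable_lattice_exists:
  assumes M: "rat_mat n M" and ev: "\<forall>\<^sub>F x::real in cofinite. \<forall>k. coeff (char_poly (M x)) k = poly (c k) (of_real x)"
  shows "\<exists>W. stable_lattice n c M W"
proof -
  have Mc: "M x \<in> carrier_mat n n" for x using M by (auto simp: rat_mat_def)
  define H where "H x k = horner_mat n (\<lambda>k. poly (c k) (of_real x)) (M x) k" for x :: real and k
  have Hc: "H x k \<in> carrier_mat n n" for x k unfolding H_def using Mc by simp
  have Hr: "rat_mat n (\<lambda>x. H x k)" for k unfolding H_def by (rule rat_mat_horner[OF M])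
  have "\<exists>d h. d \<noteq> 0 \<and> (\<forall>t\<in>{..n} \<times> {..<n} \<times> {..<n}.
      \<forall>\<^sub>F x in cofinite. poly d (of_real x) * H x (fst t) $$ snd t = poly (h t) (of_real x))"
    by (rule ratf_common_denominator[where f = "\<lambda>t x. H x (fst t) $$ snd t"])
       (use Hr in \<open>auto simp: rat_mat_def\<close>)
  then obtain d h where d: "d \<noteq> 0" and h: "\<forall>t\<in>{..n} \<times> {..<n} \<times> {..<n}.
      \<forall>\<^sub>F x in cofinite. poly d (of_real x) * H x (fst t) $$ snd t = poly (h t) (of_real x)"
    by blast
  have h': "\<forall>\<^sub>F x in cofinite. \<forall>t\<in>{..n} \<times> {..<n} \<times> {..<n}.
      poly d (of_real x) * H x (fst t) $$ snd t = poly (h t) (of_real x)"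
    by (intro eventually_ball_finite h) auto
  define W where "W j = mat n n (\<lambda>ij. h (n - j, ij))" for j
  have Wc: "W j \<in> carrier_mat n n" for j by (simp add: W_def)
  have W: "\<forall>\<^sub>F x::real in cofinite. \<forall>j\<le>n. eval_mat (W j) (of_real x) = poly d (of_real x) \<cdot>\<^sub>m H x (n - j)"
    using h'
  proof eventually_elim
    case (elim x)
    show ?case
    proof (intro allI impI eq_matI)
      fix j k l assume "j \<le> n" "k < dim_row (poly d (of_real x) \<cdot>\<^sub>m H x (n - j))" "l < dim_col (poly d (of_real x) \<cdot>\<^sub>m H x (n - j))"
      then have kl: "k < n" "l < n" using Hc[of x "n - j"] by auto
      then have "poly d (of_real x) * H x (n - j) $$ (k, l) = poly (h (n - j, k, l)) (of_real x)"
        using elim by auto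
      then show "eval_mat (W j) (of_real x) $$ (k, l) = (poly d (of_real x) \<cdot>\<^sub>m H x (n - j)) $$ (k, l)"
        using kl Hc[of x "n - j"] by (simp add: W_def eval_mat_def)
    qed (use carrier_matD[OF Hc] in \<open>auto simp: W_def eval_mat_def\<close>)
  qed
  have "W 0 = 0\<^sub>m n n"
  proof (rule mat_eq_0_if_cofinite[OF Wc])
    show "\<forall>\<^sub>F x::real in cofinite. eval_mat (W 0) (of_real x) = 0\<^sub>m n n"
      using W ev
    proof eventually_elim
      case (elim x)
      have "H x n = horner_mat n (coeff (char_poly (M x))) (M x) n"
        unfolding H_def using elim(2) by (metis (no_types, lifting) ext)
      then have "H x n = 0\<^sub>m n n" using cayley_hamilton_horner[OF Mc] by simp
      then show ?case using elim(1) by (auto intro!: eq_matI)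
    qed
  qed
  moreover have "det (W n) \<noteq> 0"
  proof
    assume "det (W n) = 0"
    then have "det (eval_mat (W n) z) = 0" for z by (simp add: det_eval_mat)
    moreover have "\<forall>\<^sub>F x::real in cofinite. det (eval_mat (W n) (of_real x)) \<noteq> 0"
      using W eventually_cofinite_poly_neq_0[OF d]
      by eventually_elim (simp add: H_def)
    ultimately show False by (simp add: infinite_UNIV_char_0)
  qed
  moreover have "\<forall>\<^sub>F x::real in cofinite. M x * eval_mat (W (Suc j)) (of_real x) =
        eval_mat (W j) (of_real x) - poly (c j) (of_real x) \<cdot>\<^sub>m eval_mat (W n) (of_real x)" if j: "j < n" for j
    using W
  proof eventually_elim
    case (elim x)
    define \<kappa> where "\<kappa> = poly d (of_real x)"
    have H: "H x (n - j) = M x * H x (n - Suc j) + poly (c j) (of_real x) \<cdot>\<^sub>m 1\<^sub>m n"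
    proof -
      have "n - j = Suc (n - Suc j)" "n - Suc (n - Suc j) = j" using j by auto
      then show ?thesis unfolding H_def by simp
    qed
    have "eval_mat (W j) (of_real x) - poly (c j) (of_real x) \<cdot>\<^sub>m eval_mat (W n) (of_real x)
       = \<kappa> \<cdot>\<^sub>m (M x * H x (n - Suc j) + poly (c j) (of_real x) \<cdot>\<^sub>m 1\<^sub>m n) - poly (c j) (of_real x) \<cdot>\<^sub>m (\<kappa> \<cdot>\<^sub>m 1\<^sub>m n)"
      using elim j by (simp add: H \<kappa>_def) (simp add: H_def)
    also have "\<dots> = \<kappa> \<cdot>\<^sub>m (M x * H x (n - Suc j))"
      using Mc[of x] Hc[of x "n - Suc j"] by (intro eq_matI) (auto simp: algebra_simps)
    also have "\<dots> = M x * (\<kappa> \<cdot>\<^sub>m H x (n - Suc j))"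
      using mult_smult_distrib[OF Mc Hc] by simp
    also have "\<kappa> \<cdot>\<^sub>m H x (n - Suc j) = eval_mat (W (Suc j)) (of_real x)"
      using elim j by (simp add: \<kappa>_def)
    finally show ?case by simp
  qed
  ultimately show ?thesis unfolding stable_lattice_def using Wc by blast
qed

section \<open>Blaschke--Potapov reflection of a lattice\<close>

lemma mat_adjoint_carrier [simp]: "A \<in> carrier_mat n m \<Longrightarrow> mat_adjoint A \<in> carrier_mat m n"
  by (auto simp: mat_adjoint_def)

lemma mat_adjoint_index:
  fixes A :: "complex mat"
  shows "A \<in> carrier_mat n m \<Longrightarrow> i < m \<Longrightarrow> j < n \<Longrightarrow> mat_adjoint A $$ (i, j) = cnj (A $$ (j, i))"
  by (simp add: mat_adjoint_def mat_of_rows_def conjugate_complex_def)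

lemma mat_adjoint_mult:
  fixes A B :: "complex mat"
  assumes A: "A \<in> carrier_mat n n" and B: "B \<in> carrier_mat n n"
  shows "mat_adjoint (A * B) = mat_adjoint B * mat_adjoint A"
proof (rule eq_matI)
  have dims: "mat_adjoint (A * B) \<in> carrier_mat n n" "mat_adjoint B * mat_adjoint A \<in> carrier_mat n n"
    by (rule mat_adjoint_carrier[OF mult_carrier_mat[OF A B]],
        rule mult_carrier_mat[OF mat_adjoint_carrier[OF B] mat_adjoint_carrier[OF A]])
  then show "dim_row (mat_adjoint (A * B)) = dim_row (mat_adjoint B * mat_adjoint A)"
    "dim_col (mat_adjoint (A * B)) = dim_col (mat_adjoint B * mat_adjoint A)" by auto
  fix i j assume "i < dim_row (mat_adjoint B * mat_adjoint A)" "j < dim_col (mat_adjoint B * mat_adjoint A)"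
  then have ij: "i < n" "j < n" using dims by auto
  have "mat_adjoint (A * B) $$ (i, j) = cnj (\<Sum>k<n. A $$ (j, k) * B $$ (k, i))"
    using ij A B by (subst mat_adjoint_index[of _ n n]) (auto simp: index_mult_mat_sum[OF A B] simp del: index_mult_mat)
  also have "\<dots> = (\<Sum>k<n. mat_adjoint B $$ (i, k) * mat_adjoint A $$ (k, j))"
    unfolding cnj_sum by (rule sum.cong) (use ij A B in \<open>auto simp: mat_adjoint_index\<close>)
  also have "\<dots> = (mat_adjoint B * mat_adjoint A) $$ (i, j)"
    using ij A B by (subst index_mult_mat_sum[of _ n n _ n]) auto
  finally show "mat_adjoint (A * B) $$ (i, j) = (mat_adjoint B * mat_adjoint A) $$ (i, j)" .
qed

text \<open>The matrix determinant lemma. The block unitriangular \<open>L\<close> satisfies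
  \<open>L * A = B * L\<close>, where \<open>A\<close> is block triangular with diagonal blocks
  \<open>1 + P\<close> and 1, and \<open>B\<close> with diagonal blocks 1 and
  \<open>s\<close>.\<close>

lemma det_one_plus_rank_one:
  fixes v w :: "'a::idom vec"
  assumes v: "v \<in> carrier_vec n" and w: "w \<in> carrier_vec n"
  shows "det (1\<^sub>m n + mat n n (\<lambda>(i, j). v $ i * w $ j)) = 1 + (\<Sum>i<n. w $ i * v $ i)"
proof -
  define V where "V = mat n 1 (\<lambda>(i, j). v $ i)"
  define R where "R = mat 1 n (\<lambda>(i, j). w $ j)"
  define s where "s = mat 1 1 (\<lambda>_. (1::'a) + (\<Sum>i<n. w $ i * v $ i))"
  have c: "V \<in> carrier_mat n 1" "R \<in> carrier_mat 1 n" "s \<in> carrier_mat 1 1" by (auto simp: V_def R_def s_def)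
  define P where "P = mat n n (\<lambda>(i, j). v $ i * w $ j)"
  have P: "P \<in> carrier_mat n n" by (simp add: P_def)
  have VR: "V * R = P" by (rule eq_matI) (auto simp: V_def R_def P_def scalar_prod_def)
  have RV: "1\<^sub>m 1 + R * V = s" by (rule eq_matI) (auto simp: V_def R_def s_def scalar_prod_def atLeast0LessThan)
  define L where "L = four_block_mat (1\<^sub>m n) (0\<^sub>m n 1) R (1\<^sub>m 1)"
  define A where "A = four_block_mat (1\<^sub>m n + P) V (0\<^sub>m 1 n) (1\<^sub>m 1)"
  define B where "B = four_block_mat (1\<^sub>m n) V (0\<^sub>m 1 n) s"
  have LA: "L * A = four_block_mat (1\<^sub>m n + P) V (R * (1\<^sub>m n + P)) (R * V + 1\<^sub>m 1)"
    unfolding L_def A_def using c P by (subst mult_four_block_mat[of _ n n _ 1 _ 1 _ _ n _ 1]) auto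
  have BL: "B * L = four_block_mat (1\<^sub>m n + V * R) V (s * R) s"
    unfolding L_def B_def using c P by (subst mult_four_block_mat[of _ n n _ 1 _ 1 _ _ n _ 1]) auto
  have "R * (1\<^sub>m n + P) = R * 1\<^sub>m n + R * P" using c P by (intro mult_add_distrib_mat) auto
  also have "R * P = R * V * R" unfolding VR[symmetric] using c by simp
  also have "R * 1\<^sub>m n + R * V * R = (1\<^sub>m 1 + R * V) * R"
    using c by (subst add_mult_distrib_mat[of _ 1 1]) auto
  finally have "R * (1\<^sub>m n + P) = s * R" by (simp only: RV)
  moreover have "R * V + 1\<^sub>m 1 = s" unfolding RV[symmetric] using c by (intro comm_add_mat) auto
  ultimately have "L * A = B * L" unfolding LA BL VR by simp
  moreover have Lc: "L \<in> carrier_mat (n + 1) (n + 1)" "A \<in> carrier_mat (n + 1) (n + 1)" "B \<in> carrier_mat (n + 1) (n + 1)"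
    unfolding L_def A_def B_def using c P by auto
  ultimately have "det L * det A = det B * det L" by (metis det_mult)
  moreover have "det L = 1"
    unfolding L_def using c by (subst det_four_block_mat_upper_right_zero[of _ n _ 1]) auto
  moreover have "det A = det (1\<^sub>m n + P)"
    unfolding A_def using c P by (subst det_four_block_mat_lower_left_zero[of _ n _ 1]) auto
  moreover have "det B = det s"
    unfolding B_def using c P by (subst det_four_block_mat_lower_left_zero[of _ n _ 1]) auto
  moreover have "det s = 1 + (\<Sum>i<n. w $ i * v $ i)"
    using c(3) by (subst det_single) (auto simp: s_def)
  ultimately show ?thesis by (simp add: P_def)
qed

text \<open>Replacing \<open>M\<close> by \<open>U M U\<^sup>*\<close> and \<open>W\<close> by \<open>U W\<close>, with the unitary factor
  \<open>U = 1 + (b - 1) v v\<^sup>*\<close> for the Blaschke quotient \<open>b = (x - cnj \<alpha>) / (x - \<alpha>)\<close>, reflects one zero of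
  \<open>det (W n)\<close> into the lower half-plane.\<close>

lemma stable_lattice_reflect:
  fixes M :: "real \<Rightarrow> complex mat"
  assumes M: "rat_mat n M" and herm: "\<forall>\<^sub>F x in cofinite. hermitian_mat (M x) \<and> char_poly (M x) = q x"
    and W: "stable_lattice n c M W" and \<alpha>: "Im \<alpha> \<noteq> 0"
    and v: "(\<Sum>k<n. v k * cnj (v k)) = 1"
    and ker: "\<And>j l. j \<le> n \<Longrightarrow> l < n \<Longrightarrow> (\<Sum>k<n. cnj (v k) * poly (W j $$ (k, l)) \<alpha>) = 0"
  shows "\<exists>M' W'. rat_mat n M' \<and> (\<forall>\<^sub>F x in cofinite. hermitian_mat (M' x) \<and> char_poly (M' x) = q x)
     \<and> stable_lattice n c M' W' \<and> det (W' n) * [:- \<alpha>, 1:] = det (W n) * [:- cnj \<alpha>, 1:]"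
proof -
  have Mc: "M x \<in> carrier_mat n n" for x using M by (auto simp: rat_mat_def)
  have Wc: "W j \<in> carrier_mat n n" if "j \<le> n" for j using W that by (auto simp: stable_lattice_def)
  define g where "g x = (\<alpha> - cnj \<alpha>) / (complex_of_real x - \<alpha>)" for x
  define P where "P = mat n n (\<lambda>(i, j). v i * cnj (v j))"
  define U where "U x = 1\<^sub>m n + g x \<cdot>\<^sub>m P" for x
  define V where "V x = 1\<^sub>m n + cnj (g x) \<cdot>\<^sub>m P" for x
  have P: "P \<in> carrier_mat n n" by (simp add: P_def)
  have Uc: "U x \<in> carrier_mat n n" and Vc: "V x \<in> carrier_mat n n" for x using P by (auto simp: U_def V_def)
  have nr: "complex_of_real x - \<alpha> \<noteq> 0" "complex_of_real x - cnj \<alpha> \<noteq> 0" for x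
    using \<alpha> by (auto simp: complex_eq_iff)
  \<comment> \<open>With b = 1 + g this says b cnj b = 1 on the real line. It makes \<open>U\<close>
    unitary there, with inverse and adjoint \<open>V\<close>.\<close>
  have gg: "g x + cnj (g x) + g x * cnj (g x) = 0" for x
  proof -
    have "(w - u) / u + (u - w) / w + (w - u) / u * ((u - w) / w) = 0" if "u \<noteq> 0" "w \<noteq> 0" for u w :: complex
      using that by (simp add: field_simps)
    from this[OF nr[of x]] show ?thesis by (simp add: g_def)
  qed
  have PP: "P * P = P"
  proof (rule eq_matI)
    fix i j assume "i < dim_row P" "j < dim_col P"
    then have ij: "i < n" "j < n" using P by auto
    have "(P * P) $$ (i, j) = (\<Sum>k<n. P $$ (i, k) * P $$ (k, j))"
      by (rule index_mult_mat_sum[OF P P ij])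
    also have "\<dots> = (\<Sum>k<n. v i * cnj (v j) * (v k * cnj (v k)))"
      by (rule sum.cong) (use ij in \<open>auto simp: P_def\<close>)
    also have "\<dots> = P $$ (i, j)" using ij v by (simp add: P_def flip: sum_distrib_left)
    finally show "(P * P) $$ (i, j) = P $$ (i, j)" .
  qed (use P in auto)
  \<comment> \<open>\<open>P\<close> is the orthogonal projection onto the line of \<open>v\<close>,
    on which 1 + a P acts as the scalar 1 + a; these scalars multiply.\<close>
  have prod: "(1\<^sub>m n + a \<cdot>\<^sub>m P) * (1\<^sub>m n + b \<cdot>\<^sub>m P) = 1\<^sub>m n + (a + b + a * b) \<cdot>\<^sub>m P" for a b
  proof -
    have aP: "a \<cdot>\<^sub>m P \<in> carrier_mat n n" "b \<cdot>\<^sub>m P \<in> carrier_mat n n" using P by auto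
    have "(1\<^sub>m n + a \<cdot>\<^sub>m P) * (1\<^sub>m n + b \<cdot>\<^sub>m P) = 1\<^sub>m n * (1\<^sub>m n + b \<cdot>\<^sub>m P) + (a \<cdot>\<^sub>m P) * (1\<^sub>m n + b \<cdot>\<^sub>m P)"
      by (rule add_mult_distrib_mat[OF one_carrier_mat aP(1) add_carrier_mat[OF aP(2)]])
    also have "(a \<cdot>\<^sub>m P) * (1\<^sub>m n + b \<cdot>\<^sub>m P) = a \<cdot>\<^sub>m P * 1\<^sub>m n + a \<cdot>\<^sub>m P * (b \<cdot>\<^sub>m P)"
      by (rule mult_add_distrib_mat[OF aP(1) one_carrier_mat aP(2)])
    also have "a \<cdot>\<^sub>m P * (b \<cdot>\<^sub>m P) = a \<cdot>\<^sub>m (b \<cdot>\<^sub>m P)"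
      by (simp only: mult_smult_assoc_mat[OF P aP(2)] mult_smult_distrib[OF P P] PP)
    finally show ?thesis using P aP by (intro eq_matI) (auto simp: algebra_simps)
  qed
  have zP: "1\<^sub>m n + (0::complex) \<cdot>\<^sub>m P = 1\<^sub>m n" by (rule eq_matI) (use P in auto)
  have UV: "U x * V x = 1\<^sub>m n" for x unfolding U_def V_def prod gg zP ..
  have VU: "V x * U x = 1\<^sub>m n" for x
  proof -
    have "cnj (g x) + g x + cnj (g x) * g x = 0" using gg[of x] by (simp add: algebra_simps)
    then show ?thesis unfolding U_def V_def prod by (simp add: zP)
  qed
  have adjU: "mat_adjoint (U x) = V x" and adjV: "mat_adjoint (V x) = U x" for x
    by (rule eq_matI; use Uc[of x] Vc[of x] P in \<open>auto simp: mat_adjoint_index\<close>;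
        auto simp: U_def V_def P_def mat_adjoint_def)+
  define M' where "M' x = U x * M x * V x" for x
  have gr: "ratf g" unfolding g_def using ratf_poly[of "[:-\<alpha>, 1:]"] by (intro ratf_divide) auto
  have "rat_mat n M'" unfolding M'_def U_def V_def
    using M P gr by (intro rat_mat_mult rat_mat_add rat_mat_smult rat_mat_const ratf_cnj) auto
  moreover have "\<forall>\<^sub>F x in cofinite. hermitian_mat (M' x) \<and> char_poly (M' x) = q x"
    using herm
  proof eventually_elim
    case (elim x)
    have "mat_adjoint (M' x) = mat_adjoint (V x) * mat_adjoint (U x * M x)"
      unfolding M'_def using Uc Mc Vc by (intro mat_adjoint_mult mult_carrier_mat)
    also have "mat_adjoint (U x * M x) = mat_adjoint (M x) * mat_adjoint (U x)"
      using Uc Mc by (intro mat_adjoint_mult)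
    also have "mat_adjoint (M x) = M x" using elim by (simp add: hermitian_mat_def)
    finally have "mat_adjoint (M' x) = U x * (M x * V x)" by (simp only: adjU adjV)
    then have "hermitian_mat (M' x)"
      unfolding hermitian_mat_def M'_def using assoc_mult_mat[OF Uc Mc Vc] by simp
    moreover have "similar_mat (M' x) (M x)" unfolding similar_mat_def
      by (rule exI[of _ "U x"], rule exI[of _ "V x"], unfold similar_mat_wit_def Let_def)
         (use Uc[of x] Vc[of x] Mc[of x] UV VU in \<open>auto simp: M'_def\<close>)
    ultimately show ?case using elim char_poly_similar by metis
  qed
  \<comment> \<open>This is \<open>U * W j\<close> written out. The pole of \<open>U\<close> at
    \<alpha> cancels because \<open>ker\<close> makes the row v^* W_j vanish at \<alpha>, so the
    division is exact.\<close>
  moreover define W' where "W' j = mat n n (\<lambda>(i, l). W j $$ (i, l)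
     + [:(\<alpha> - cnj \<alpha>) * v i:] * ((\<Sum>k<n. [:cnj (v k):] * W j $$ (k, l)) div [:-\<alpha>, 1:]))" for j
  have W'c: "W' j \<in> carrier_mat n n" for j by (simp add: W'_def)
  have evW': "eval_mat (W' j) (of_real x) = U x * eval_mat (W j) (of_real x)" if j: "j \<le> n" for j x
  proof (rule eq_matI)
    have EW: "eval_mat (W j) (of_real x) \<in> carrier_mat n n" using Wc[OF j] by simp
    show "dim_row (eval_mat (W' j) (of_real x)) = dim_row (U x * eval_mat (W j) (of_real x))"
      "dim_col (eval_mat (W' j) (of_real x)) = dim_col (U x * eval_mat (W j) (of_real x))"
      using Uc[of x] EW W'c[of j] by (auto simp: eval_mat_def)
    fix i l assume "i < dim_row (U x * eval_mat (W j) (of_real x))" "l < dim_col (U x * eval_mat (W j) (of_real x))"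
    then have il: "i < n" "l < n" using Uc[of x] EW by auto
    define y where "y = (\<Sum>k<n. [:cnj (v k):] * W j $$ (k, l))"
    have "poly y \<alpha> = 0" using ker[OF j il(2)] by (simp add: y_def poly_sum)
    then have "[:-\<alpha>, 1:] * (y div [:-\<alpha>, 1:]) = y"
      by (intro dvd_mult_div_cancel) (simp only: poly_eq_0_iff_dvd)
    then have "poly ([:-\<alpha>, 1:] * (y div [:-\<alpha>, 1:])) (of_real x) = poly y (of_real x)" by (rule arg_cong)
    then have "(of_real x - \<alpha>) * poly (y div [:-\<alpha>, 1:]) (of_real x) = poly y (of_real x)"
      by (simp add: algebra_simps)
    then have yd: "poly (y div [:-\<alpha>, 1:]) (of_real x) = poly y (of_real x) / (of_real x - \<alpha>)"
      using nr[of x] by (simp add: field_simps)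
    have "(U x * eval_mat (W j) (of_real x)) $$ (i, l) = (\<Sum>k<n. U x $$ (i, k) * poly (W j $$ (k, l)) (of_real x))"
      unfolding index_mult_mat_sum[OF Uc EW il]
      by (rule sum.cong) (use il eval_mat_index[OF Wc[OF j]] in auto)
    also have "\<dots> = (\<Sum>k<n. (if k = i then poly (W j $$ (i, l)) (of_real x) else 0)
         + g x * v i * (cnj (v k) * poly (W j $$ (k, l)) (of_real x)))"
      by (rule sum.cong) (use il P in \<open>auto simp: U_def P_def algebra_simps\<close>)
    also have "\<dots> = poly (W j $$ (i, l)) (of_real x) + g x * v i * poly y (of_real x)"
      using il by (simp add: sum.distrib y_def poly_sum sum_distrib_left)
    also have "\<dots> = poly (W' j $$ (i, l)) (of_real x)"
    proof -
      have "W' j $$ (i, l) = W j $$ (i, l) + [:(\<alpha> - cnj \<alpha>) * v i:] * (y div [:-\<alpha>, 1:])"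
        using il by (simp add: W'_def y_def)
      then show ?thesis by (simp add: yd g_def)
    qed
    finally show "eval_mat (W' j) (of_real x) $$ (i, l) = (U x * eval_mat (W j) (of_real x)) $$ (i, l)"
      using il W'c[of j] by simp
  qed
  \<comment> \<open>The determinant lemma and the norm 1 of \<open>v\<close> give det U = 1 + g = (x
    - cnj \<alpha>) / (x - \<alpha>).\<close>
  have det': "det (W' n) * [:- \<alpha>, 1:] = det (W n) * [:- cnj \<alpha>, 1:]"
  proof (rule poly_eq_if_cofinite_real, rule always_eventually, rule allI)
    fix x :: real
    have "U x = 1\<^sub>m n + mat n n (\<lambda>(i, j). vec n (\<lambda>i. g x * v i) $ i * vec n (\<lambda>j. cnj (v j)) $ j)"
      by (rule eq_matI) (auto simp: U_def P_def)
    then have "det (U x) = 1 + (\<Sum>i<n. vec n (\<lambda>j. cnj (v j)) $ i * vec n (\<lambda>i. g x * v i) $ i)"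
      by (simp only: det_one_plus_rank_one vec_carrier)
    also have "(\<Sum>i<n. vec n (\<lambda>j. cnj (v j)) $ i * vec n (\<lambda>i. g x * v i) $ i) = g x * (\<Sum>i<n. v i * cnj (v i))"
      unfolding sum_distrib_left by (rule sum.cong) (auto simp: mult_ac)
    finally have dU: "det (U x) = 1 + g x" by (simp add: v)
    have "poly (det (W' n)) (of_real x) = det (U x * eval_mat (W n) (of_real x))"
      by (simp add: evW' flip: det_eval_mat)
    also have "\<dots> = (1 + g x) * poly (det (W n)) (of_real x)"
      using det_mult[OF Uc eval_mat_carrier[OF Wc]] by (simp add: dU det_eval_mat)
    finally have "poly (det (W' n)) (of_real x) * (of_real x - \<alpha>) = ((1 + g x) * (of_real x - \<alpha>)) * poly (det (W n)) (of_real x)"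
      by simp
    also have "(1 + g x) * (of_real x - \<alpha>) = of_real x - cnj \<alpha>"
      using nr[of x] by (simp add: g_def field_simps)
    finally show "poly (det (W' n) * [:- \<alpha>, 1:]) (of_real x) = poly (det (W n) * [:- cnj \<alpha>, 1:]) (of_real x)"
      by (simp add: algebra_simps)
  qed
  have "stable_lattice n c M' W'" unfolding stable_lattice_def
  proof (intro conjI allI impI)
    show "W' j \<in> carrier_mat n n" for j by (rule W'c)
    show "W' 0 = 0\<^sub>m n n" using W by (intro eq_matI) (auto simp: W'_def stable_lattice_def)
    have "det (W n) \<noteq> 0" using W by (simp add: stable_lattice_def)
    then have "det (W n) * [:- cnj \<alpha>, 1:] \<noteq> 0" by (simp only: mult_eq_0_iff) simp
    then show "det (W' n) \<noteq> 0" unfolding det'[symmetric] by auto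
    fix j assume j: "j < n"
    have "\<forall>\<^sub>F x::real in cofinite. M x * eval_mat (W (Suc j)) (of_real x) =
        eval_mat (W j) (of_real x) - poly (c j) (of_real x) \<cdot>\<^sub>m eval_mat (W n) (of_real x)"
      using W j by (simp add: stable_lattice_def)
    then show "\<forall>\<^sub>F x::real in cofinite. M' x * eval_mat (W' (Suc j)) (of_real x) =
        eval_mat (W' j) (of_real x) - poly (c j) (of_real x) \<cdot>\<^sub>m eval_mat (W' n) (of_real x)"
    proof eventually_elim
      case (elim x)
      define A where "A k = eval_mat (W k) (of_real x)" for k
      have Ac: "A k \<in> carrier_mat n n" if "k \<le> n" for k using Wc[OF that] by (simp add: A_def)
      have ASc: "A (Suc j) \<in> carrier_mat n n" using j by (intro Ac) simp
      have "M' x * eval_mat (W' (Suc j)) (of_real x) = U x * M x * V x * (U x * A (Suc j))"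
        using j by (simp add: M'_def evW' A_def)
      also have "\<dots> = U x * M x * (V x * (U x * A (Suc j)))"
        by (rule assoc_mult_mat[OF mult_carrier_mat[OF Uc Mc] Vc mult_carrier_mat[OF Uc ASc]])
      also have "V x * (U x * A (Suc j)) = V x * U x * A (Suc j)"
        by (rule assoc_mult_mat[symmetric, OF Vc Uc ASc])
      also have "\<dots> = A (Suc j)" unfolding VU using ASc by simp
      also have "U x * M x * A (Suc j) = U x * (M x * A (Suc j))"
        by (rule assoc_mult_mat[OF Uc Mc ASc])
      also have "M x * A (Suc j) = A j - poly (c j) (of_real x) \<cdot>\<^sub>m A n" using elim by (simp add: A_def)
      also have "U x * (A j - poly (c j) (of_real x) \<cdot>\<^sub>m A n) = U x * A j - U x * (poly (c j) (of_real x) \<cdot>\<^sub>m A n)"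
        using j by (intro mult_minus_distrib_mat[OF Uc Ac smult_carrier_mat[OF Ac]]) auto
      also have "U x * (poly (c j) (of_real x) \<cdot>\<^sub>m A n) = poly (c j) (of_real x) \<cdot>\<^sub>m (U x * A n)"
        by (rule mult_smult_distrib[OF Uc Ac]) simp
      finally show ?case using j by (simp add: A_def evW')
    qed
  qed
  ultimately show ?thesis using det' by blast
qed

section \<open>Removal of poles\<close>

text \<open>The last conclusion says that at each \<alpha> in the upper half-plane the columns of
  all W_j(\<alpha>) span the whole space. If a nonzero row vector \<open>u\<close> annihilates them,
  normalizing it and reflecting trades a root \<alpha> of det (W n) for cnj \<alpha>, so the number
  of roots in the upper half-plane, with multiplicity, drops.\<close>

lemma saturated_lattice_exists:
  assumes "rat_mat n M" "\<forall>\<^sub>F x in cofinite. hermitian_mat (M x) \<and> char_poly (M x) = q x"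
    and "stable_lattice n c M W"
  shows "\<exists>M W. rat_mat n M \<and> (\<forall>\<^sub>F x in cofinite. hermitian_mat (M x) \<and> char_poly (M x) = q x)
    \<and> stable_lattice n c M W \<and>
    (\<forall>\<alpha> u. Im \<alpha> > 0 \<longrightarrow> (\<forall>j\<le>n. \<forall>l<n. (\<Sum>k<n. u k * poly (W j $$ (k, l)) \<alpha>) = 0) \<longrightarrow> (\<forall>k<n. u k = 0))"
  using assms
proof (induction "size (filter_mset (\<lambda>z. Im z > 0) (proots (det (W n))))" arbitrary: M W rule: less_induct)
  case less
  show ?case
  proof (cases "\<forall>\<alpha> u. Im \<alpha> > 0 \<longrightarrow> (\<forall>j\<le>n. \<forall>l<n. (\<Sum>k<n. u k * poly (W j $$ (k, l)) \<alpha>) = 0) \<longrightarrow> (\<forall>k<n. u k = 0)")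
    case True
    then show ?thesis using less.prems by blast
  next
    case False
    then obtain \<alpha> u m where \<alpha>: "Im \<alpha> > 0" and um: "m < n" "u m \<noteq> 0"
      and ker: "\<And>j l. j \<le> n \<Longrightarrow> l < n \<Longrightarrow> (\<Sum>k<n. u k * poly (W j $$ (k, l)) \<alpha>) = 0" by blast
    define s where "s = (\<Sum>k<n. (cmod (u k))\<^sup>2)"
    have "(cmod (u m))\<^sup>2 \<le> s" unfolding s_def by (rule member_le_sum) (use um in auto)
    moreover have "(cmod (u m))\<^sup>2 > 0" using um by simp
    ultimately have s: "s > 0" by linarith
    define v where "v k = cnj (u k) / of_real (sqrt s)" for k
    have ss: "complex_of_real (sqrt s) * complex_of_real (sqrt s) = of_real s"
      using s by (simp flip: of_real_mult)
    have "(\<Sum>k<n. v k * cnj (v k)) = (\<Sum>k<n. u k * cnj (u k) / of_real s)"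
      by (rule sum.cong) (simp_all add: v_def ss)
    also have "\<dots> = of_real s / of_real s"
      unfolding s_def by (simp only: of_real_sum complex_norm_square sum_divide_distrib)
    finally have v: "(\<Sum>k<n. v k * cnj (v k)) = 1" using s by simp
    have ker': "(\<Sum>k<n. cnj (v k) * poly (W j $$ (k, l)) \<alpha>) = 0" if "j \<le> n" "l < n" for j l
    proof -
      have "(\<Sum>k<n. cnj (v k) * poly (W j $$ (k, l)) \<alpha>)
          = (\<Sum>k<n. u k * poly (W j $$ (k, l)) \<alpha>) / of_real (sqrt s)"
        unfolding sum_divide_distrib by (rule sum.cong) (simp_all add: v_def)
      then show ?thesis using ker[OF that] by simp
    qed
    have "Im \<alpha> \<noteq> 0" using \<alpha> by simp
    from stable_lattice_reflect[OF less.prems this v ker'] obtain M' W' where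
      M': "rat_mat n M'" "\<forall>\<^sub>F x in cofinite. hermitian_mat (M' x) \<and> char_poly (M' x) = q x"
        "stable_lattice n c M' W'" and det: "det (W' n) * [:- \<alpha>, 1:] = det (W n) * [:- cnj \<alpha>, 1:]"
      by blast
    have nz: "det (W' n) \<noteq> 0" "det (W n) \<noteq> 0" using M'(3) less.prems(3) by (auto simp: stable_lattice_def)
    have "proots (det (W' n) * [:- \<alpha>, 1:]) = proots (det (W' n)) + {#\<alpha>#}"
      using nz by (subst proots_mult) auto
    moreover have "proots (det (W n) * [:- cnj \<alpha>, 1:]) = proots (det (W n)) + {#cnj \<alpha>#}"
      using nz by (subst proots_mult) auto
    ultimately have "proots (det (W' n)) + {#\<alpha>#} = proots (det (W n)) + {#cnj \<alpha>#}"
      using det by simp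
    then have "filter_mset (\<lambda>z. Im z > 0) (proots (det (W' n)) + {#\<alpha>#})
        = filter_mset (\<lambda>z. Im z > 0) (proots (det (W n)) + {#cnj \<alpha>#})" by (rule arg_cong)
    then have "filter_mset (\<lambda>z. Im z > 0) (proots (det (W' n))) + {#\<alpha>#}
        = filter_mset (\<lambda>z. Im z > 0) (proots (det (W n)))" using \<alpha> by simp
    then have "size (filter_mset (\<lambda>z. Im z > 0) (proots (det (W' n))))
        < size (filter_mset (\<lambda>z. Im z > 0) (proots (det (W n))))"
      by (metis add.right_neutral add_mset_add_single lessI size_add_mset)
    from less.hyps[OF this M'] show ?thesis .
  qed
qed

section \<open>Bounds from the trace of the square\<close>

text \<open>Newton's identity for the second power sum; the coefficients 1 and 2 of \<open>g\<close>
  are, up to sign, the first two elementary symmetric functions.\<close>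

lemma sum_squares_linear_factors:
  fixes es :: "'a::comm_ring_1 list"
  defines "g \<equiv> (\<Prod>e\<leftarrow>es. [:1, - e:])"
  shows "(\<Sum>e\<leftarrow>es. e * e) = (coeff g 1)\<^sup>2 - 2 * coeff g 2"
proof -
  have "coeff g 0 = 1 \<and> (\<Sum>e\<leftarrow>es. e * e) = (coeff g 1)\<^sup>2 - 2 * coeff g 2"
    unfolding g_def
  proof (induction es)
    case Nil
    show ?case by (simp add: coeff_1)
  next
    case (Cons e es)
    define h where "h = (\<Prod>e\<leftarrow>es. [:1, - e:])"
    have eq: "(\<Prod>e\<leftarrow>e # es. [:1, - e:]) = h - smult e (pCons 0 h)" by (simp add: h_def)
    have "coeff h 0 = 1" "(\<Sum>e\<leftarrow>es. e * e) = (coeff h 1)\<^sup>2 - 2 * coeff h 2"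
      using Cons.IH by (simp_all add: h_def)
    moreover have "coeff (pCons 0 p) 2 = coeff p 1" for p :: "'a poly" by (simp add: numeral_2_eq_2)
    ultimately show ?case unfolding eq by (simp add: power2_eq_square algebra_simps)
  qed
  then show ?thesis by blast
qed

text \<open>Schur triangularization turns the trace of A^2 into the sum of the squared eigenvalues.
  Reflecting the characteristic polynomial puts the two relevant coefficients at the positions 1 and
  2 for every n, with value 0 beyond the degree.\<close>

lemma trace_square_char_poly:
  fixes A :: "complex mat"
  assumes A: "A \<in> carrier_mat n n"
  defines "r \<equiv> reflect_poly (char_poly A)"
  shows "(\<Sum>i<n. \<Sum>j<n. A $$ (i, j) * A $$ (j, i)) = (coeff r 1)\<^sup>2 - 2 * coeff r 2"
proof -
  obtain es where "char_poly A = (\<Prod>e\<leftarrow>es. [:- e, 1:])"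
    using char_poly_factorized[OF A] by blast
  from schur_decomposition_exists[OF A this] obtain B where
    B: "B \<in> carrier_mat n n" and ut: "upper_triangular B" and sim: "similar_mat A B" by blast
  obtain P Q where wit: "similar_mat_wit A B P Q" using sim unfolding similar_mat_def by blast
  note w = similar_mat_witD2[OF A wit]
  have P: "P \<in> carrier_mat n n" and Q: "Q \<in> carrier_mat n n" using w by auto
  have tr: "(\<Sum>i<n. (X * Y) $$ (i, i)) = (\<Sum>i<n. (Y * X) $$ (i, i))"
    if X: "X \<in> carrier_mat n n" and Y: "Y \<in> carrier_mat n n" for X Y :: "complex mat"
  proof -
    have "(\<Sum>i<n. (X * Y) $$ (i, i)) = (\<Sum>i<n. \<Sum>k<n. X $$ (i, k) * Y $$ (k, i))"
      by (rule sum.cong) (simp_all add: index_mult_mat_sum[OF X Y] del: index_mult_mat)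
    also have "\<dots> = (\<Sum>k<n. \<Sum>i<n. X $$ (i, k) * Y $$ (k, i))" by (rule sum.swap)
    also have "\<dots> = (\<Sum>k<n. (Y * X) $$ (k, k))"
      by (rule sum.cong) (simp_all add: index_mult_mat_sum[OF Y X] mult.commute del: index_mult_mat)
    finally show ?thesis .
  qed
  have BB: "B * B \<in> carrier_mat n n" using B by simp
  have "similar_mat_wit (A ^\<^sub>m 2) (B ^\<^sub>m 2) P Q" using wit by (rule similar_mat_wit_pow)
  then have "A ^\<^sub>m 2 = P * B ^\<^sub>m 2 * Q" by (simp add: similar_mat_wit_def Let_def)
  then have AA: "A * A = P * (B * B) * Q" using A B by (simp add: numeral_2_eq_2)
  have "(\<Sum>i<n. \<Sum>j<n. A $$ (i, j) * A $$ (j, i)) = (\<Sum>i<n. (A * A) $$ (i, i))"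
    by (rule sum.cong) (simp_all add: index_mult_mat_sum[OF A A] del: index_mult_mat)
  also have "\<dots> = (\<Sum>i<n. (Q * (P * (B * B))) $$ (i, i))"
    unfolding AA by (rule tr[OF mult_carrier_mat[OF P BB] Q])
  also have "Q * (P * (B * B)) = Q * P * (B * B)" by (rule assoc_mult_mat[symmetric, OF Q P BB])
  also have "\<dots> = B * B" using w BB by simp
  also have "(\<Sum>i<n. (B * B) $$ (i, i)) = (\<Sum>i<n. B $$ (i, i) * B $$ (i, i))"
  proof (rule sum.cong)
    fix i assume "i \<in> {..<n}"
    then have i: "i < n" by simp
    have "(B * B) $$ (i, i) = (\<Sum>k<n. B $$ (i, k) * B $$ (k, i))" by (rule index_mult_mat_sum[OF B B i i])
    also have "\<dots> = (\<Sum>k<n. if k = i then B $$ (i, i) * B $$ (i, i) else 0)"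
    proof (rule sum.cong)
      fix k assume "k \<in> {..<n}"
      then have "k < n" by simp
      then show "B $$ (i, k) * B $$ (k, i) = (if k = i then B $$ (i, i) * B $$ (i, i) else 0)"
        using ut i B upper_triangularD[OF ut, of k i] upper_triangularD[OF ut, of i k]
        by (cases k i rule: linorder_cases) auto
    qed simp
    finally show "(B * B) $$ (i, i) = B $$ (i, i) * B $$ (i, i)" using i by simp
  qed simp
  also have "\<dots> = (\<Sum>e\<leftarrow>diag_mat B. e * e)"
    using B by (simp add: diag_mat_def comp_def interv_sum_list_conv_sum_set_nat atLeast0LessThan)
  also have "\<dots> = (coeff r 1)\<^sup>2 - 2 * coeff r 2"
  proof -
    have "char_poly A = (\<Prod>e\<leftarrow>diag_mat B. [:- e, 1:])"
      using char_poly_similar[OF sim] char_poly_upper_triangular[OF B ut] by simp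
    moreover have "reflect_poly [:- e, 1:] = [:1, - e:]" for e :: complex
      by (simp add: reflect_poly_def cCons_def)
    ultimately have r: "r = (\<Prod>e\<leftarrow>diag_mat B. [:1, - e:])"
      unfolding r_def by (simp only: reflect_poly_prod_list map_map comp_def)
    show ?thesis unfolding r by (rule sum_squares_linear_factors)
  qed
  finally show ?thesis .
qed

lemma hermitian_matD:
  "A \<in> carrier_mat n n \<Longrightarrow> hermitian_mat A \<Longrightarrow> i < n \<Longrightarrow> j < n \<Longrightarrow> A $$ (i, j) = cnj (A $$ (j, i))"
  using hermitian_mat_iff by blast

text \<open>For Hermitian \<open>A\<close> the trace of A^2 is the sum of all |A_ij|^2, so the
  characteristic polynomial alone bounds each entry. This excludes real poles and later bounds the
  degrees.\<close>

lemma hermitian_entry_bound: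
  assumes A: "A \<in> carrier_mat n n" and h: "hermitian_mat A" and ij: "i < n" "j < n"
  defines "r \<equiv> reflect_poly (char_poly A)"
  shows "(cmod (A $$ (i, j)))\<^sup>2 \<le> Re ((coeff r 1)\<^sup>2 - 2 * coeff r 2)"
proof -
  have "(\<Sum>i<n. \<Sum>j<n. A $$ (i, j) * A $$ (j, i)) = (\<Sum>i<n. \<Sum>j<n. of_real ((cmod (A $$ (i, j)))\<^sup>2))"
  proof (intro sum.cong refl)
    fix i j assume "i \<in> {..<n}" "j \<in> {..<n}"
    then have "A $$ (j, i) = cnj (A $$ (i, j))" by (intro hermitian_matD[OF A h]) auto
    then show "A $$ (i, j) * A $$ (j, i) = of_real ((cmod (A $$ (i, j)))\<^sup>2)"
      by (simp only: complex_norm_square)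
  qed
  then have "(coeff r 1)\<^sup>2 - 2 * coeff r 2 = of_real (\<Sum>i<n. \<Sum>j<n. (cmod (A $$ (i, j)))\<^sup>2)"
    using trace_square_char_poly[OF A] unfolding r_def by (simp only: of_real_sum)
  then have eq: "Re ((coeff r 1)\<^sup>2 - 2 * coeff r 2) = (\<Sum>i<n. \<Sum>j<n. (cmod (A $$ (i, j)))\<^sup>2)"
    by (simp only: Re_complex_of_real)
  have "(cmod (A $$ (i, j)))\<^sup>2 \<le> (\<Sum>j<n. (cmod (A $$ (i, j)))\<^sup>2)"
    by (rule member_le_sum[of j]) (use ij in auto)
  also have "\<dots> \<le> (\<Sum>i<n. \<Sum>j<n. (cmod (A $$ (i, j)))\<^sup>2)"
    by (rule member_le_sum[of i _ "\<lambda>i. \<Sum>j<n. (cmod (A $$ (i, j)))\<^sup>2"]) (use ij in \<open>auto intro: sum_nonneg\<close>)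
  finally show ?thesis unfolding eq .
qed

lemma poly_map_poly_Re: "poly (map_poly Re p) x = Re (poly p (of_real x))"
  by (induction p) (simp_all add: map_poly_pCons)

text \<open>On the real line |p|^2 is the polynomial \<open>T = p * map_poly cnj p\<close>. If its
  degree 2k exceeded 2, then T - S would have a positive leading coefficient and could not be
  nonpositive for all large x.\<close>

lemma degree_le_1_if_square_bounded:
  fixes p S :: "complex poly"
  assumes S: "degree S \<le> 2" and bnd: "\<forall>\<^sub>F x::real in cofinite. (cmod (poly p (of_real x)))\<^sup>2 \<le> Re (poly S (of_real x))"
  shows "degree p \<le> 1"
proof (rule ccontr)
  assume "\<not> degree p \<le> 1"
  then have k: "degree p \<ge> 2" by simp
  define k where "k = degree p"
  have "p \<noteq> 0" using k by auto
  define T where "T = p * map_poly cnj p"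
  have T: "degree T = 2 * k" "coeff T (2 * k) = of_real ((cmod (lead_coeff p))\<^sup>2)"
  proof -
    have nz: "map_poly cnj p \<noteq> 0" "degree (map_poly cnj p) = k"
      using \<open>p \<noteq> 0\<close> by (auto simp: map_poly_eq_0_iff k_def intro!: degree_map_poly)
    show d: "degree T = 2 * k" unfolding T_def using \<open>p \<noteq> 0\<close> nz by (simp add: degree_mult_eq k_def)
    have "lead_coeff T = lead_coeff p * cnj (lead_coeff p)"
      unfolding T_def lead_coeff_mult using nz by (simp add: coeff_map_poly k_def)
    then show "coeff T (2 * k) = of_real ((cmod (lead_coeff p))\<^sup>2)"
      unfolding d by (simp only: complex_norm_square)
  qed
  define t where "t = map_poly Re (T - S)"
  have "coeff S (2 * k) = 0" using S k by (intro coeff_eq_0) (simp add: k_def)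
  then have ct: "coeff t (2 * k) = (cmod (lead_coeff p))\<^sup>2" unfolding t_def by (simp add: coeff_map_poly T)
  then have pos: "coeff t (2 * k) > 0" using \<open>p \<noteq> 0\<close> by simp
  have "degree (T - S) \<le> 2 * k" using S k T(1) by (intro degree_diff_le) (auto simp: k_def)
  then have "degree t \<le> 2 * k" unfolding t_def by (meson degree_map_poly_le le_trans)
  then have "degree t = 2 * k" using pos by (intro antisym le_degree) auto
  then have lt: "lead_coeff t > 0" using pos by simp
  then obtain m where m: "\<And>x. x \<ge> m \<Longrightarrow> poly t x \<ge> lead_coeff t" using poly_pinfty_gt_lc[OF lt] by blast
  have "\<forall>\<^sub>F x in cofinite. poly t x \<le> 0" using bnd
  proof eventually_elim
    case (elim x)
    have "poly T (of_real x) = of_real ((cmod (poly p (of_real x)))\<^sup>2)"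
      by (simp only: complex_norm_square) (simp add: T_def)
    then have "Re (poly T (of_real x)) = (cmod (poly p (of_real x)))\<^sup>2" by (simp only: Re_complex_of_real)
    then show ?case using elim by (simp add: t_def poly_map_poly_Re)
  qed
  then have "finite {x. \<not> poly t x \<le> 0}" by (simp add: eventually_cofinite)
  moreover have "{m..} \<subseteq> {x. \<not> poly t x \<le> 0}"
  proof
    fix x assume "x \<in> {m..}"
    then have "poly t x \<ge> lead_coeff t" using m by simp
    then show "x \<in> {x. \<not> poly t x \<le> 0}" using lt by simp
  qed
  ultimately have "finite {m..}" by (rule finite_subset[rotated])
  then show False by (simp add: infinite_Ici)
qed

text \<open>Write \<open>M\<close> as \<open>N / d\<close> with \<open>d\<close> of least degree.
  Any root of \<open>d\<close> turns out to be a root of all entries of \<open>N\<close>, for a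
  different reason in the upper half-plane, in the lower one and on the line; cancelling it
  contradicts minimality, so \<open>d\<close> is constant.\<close>

lemma hermitian_poly_mat_exists:
  fixes q :: "real \<Rightarrow> complex poly" and c :: "nat \<Rightarrow> complex poly"
  assumes n: "n > 0" and q: "\<And>x k. coeff (q x) k = poly (c k) (of_real x)"
    and ev: "\<forall>\<^sub>F x in cofinite. degree (q x) = n \<and> coeff (q x) n = 1 \<and> (\<forall>z. poly (q x) z = 0 \<longrightarrow> z \<in> \<real>)"
  obtains N where "N \<in> carrier_mat n n"
    "\<forall>\<^sub>F x::real in cofinite. hermitian_mat (eval_mat N (of_real x)) \<and> char_poly (eval_mat N (of_real x)) = q x"
proof -
  obtain M0 where M0: "rat_mat n M0" "\<forall>\<^sub>F x in cofinite. hermitian_mat (M0 x) \<and> char_poly (M0 x) = q x"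
    by (rule hermitian_rat_mat_exists[OF _ n ev]) (auto simp: q)
  have "\<forall>\<^sub>F x::real in cofinite. \<forall>k. coeff (char_poly (M0 x)) k = poly (c k) (of_real x)"
    using M0(2) by eventually_elim (simp add: q)
  from stable_lattice_exists[OF M0(1) this] obtain W0 where "stable_lattice n c M0 W0" ..
  from saturated_lattice_exists[OF M0 this] obtain M W where M: "rat_mat n M"
    and herm: "\<forall>\<^sub>F x in cofinite. hermitian_mat (M x) \<and> char_poly (M x) = q x"
    and W: "stable_lattice n c M W"
    and sat: "\<forall>\<alpha> u. Im \<alpha> > 0 \<longrightarrow> (\<forall>j\<le>n. \<forall>l<n. (\<Sum>k<n. u k * poly (W j $$ (k, l)) \<alpha>) = 0) \<longrightarrow> (\<forall>k<n. u k = 0)"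
    by (elim exE conjE)
  have Mc: "M x \<in> carrier_mat n n" for x using M by (auto simp: rat_mat_def)
  have Wc: "W j \<in> carrier_mat n n" if "j \<le> n" for j using W that by (auto simp: stable_lattice_def)
  define frac where "frac N d \<longleftrightarrow> N \<in> carrier_mat n n \<and> d \<noteq> 0 \<and>
    (\<forall>\<^sub>F x::real in cofinite. eval_mat N (of_real x) = poly d (of_real x) \<cdot>\<^sub>m M x)" for N d
  have entry: "\<forall>\<^sub>F x::real in cofinite. poly (N $$ (i, j)) (of_real x) = poly d (of_real x) * M x $$ (i, j)"
    if "frac N d" "i < n" "j < n" for N d i j
  proof -
    have "\<forall>\<^sub>F x::real in cofinite. eval_mat N (of_real x) = poly d (of_real x) \<cdot>\<^sub>m M x" and N: "N \<in> carrier_mat n n"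
      using that by (auto simp: frac_def)
    from this(1) show ?thesis
    proof eventually_elim
      case (elim x)
      from arg_cong[OF this, of "\<lambda>X. X $$ (i, j)"] show ?case
        using that N Mc[of x] by simp
    qed
  qed
  \<comment> \<open>By stability N W_j equals \<open>d\<close> times a polynomial matrix, so it
    vanishes at a root \<alpha> of \<open>d\<close>. Hence row \<open>i\<close> of N(\<alpha>)
    annihilates all W_j(\<alpha>) and is zero by saturation.\<close>
  have upper: "poly (N $$ (i, k)) \<alpha> = 0"
    if fr: "frac N d" and \<alpha>: "Im \<alpha> > 0" "poly d \<alpha> = 0" and ik: "i < n" "k < n" for N d \<alpha> i k
  proof (rule sat[rule_format, OF \<alpha>(1) _ ik(2)])
    fix j l assume j: "j \<le> n" and l: "l < n"
    have N: "N \<in> carrier_mat n n" using fr by (simp add: frac_def)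
    show "(\<Sum>k<n. poly (N $$ (i, k)) \<alpha> * poly (W j $$ (k, l)) \<alpha>) = 0"
    proof (cases j)
      case 0
      then show ?thesis using W l by (simp add: stable_lattice_def)
    next
      case (Suc m)
      have "\<forall>\<^sub>F x::real in cofinite. M x * eval_mat (W (Suc m)) (of_real x) =
          eval_mat (W m) (of_real x) - poly (c m) (of_real x) \<cdot>\<^sub>m eval_mat (W n) (of_real x)"
        using W j Suc by (simp add: stable_lattice_def)
      moreover have "\<forall>\<^sub>F x::real in cofinite. \<forall>k\<in>{..<n}. poly (N $$ (i, k)) (of_real x) = poly d (of_real x) * M x $$ (i, k)"
        by (rule eventually_ball_finite) (use entry[OF fr ik(1)] in auto)
      ultimately have "\<forall>\<^sub>F x::real in cofinite. poly (\<Sum>k<n. N $$ (i, k) * W (Suc m) $$ (k, l)) (of_real x)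
         = poly (d * (W m $$ (i, l) - c m * W n $$ (i, l))) (of_real x)"
      proof eventually_elim
        case (elim x)
        have E: "eval_mat (W (Suc m)) (of_real x) \<in> carrier_mat n n" using Wc j Suc by simp
        have "poly (\<Sum>k<n. N $$ (i, k) * W (Suc m) $$ (k, l)) (of_real x)
            = (\<Sum>k<n. poly d (of_real x) * (M x $$ (i, k) * eval_mat (W (Suc m)) (of_real x) $$ (k, l)))"
          unfolding poly_sum using elim(2) l Wc[of "Suc m"] j Suc by (intro sum.cong) auto
        also have "\<dots> = poly d (of_real x) * (M x * eval_mat (W (Suc m)) (of_real x)) $$ (i, l)"
          unfolding index_mult_mat_sum[OF Mc E ik(1) l] by (simp only: sum_distrib_left)
        also have "(M x * eval_mat (W (Suc m)) (of_real x)) $$ (i, l)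
            = poly (W m $$ (i, l)) (of_real x) - poly (c m) (of_real x) * poly (W n $$ (i, l)) (of_real x)"
          unfolding elim(1) using Wc[of m] Wc[of n] j Suc ik(1) l
            eval_mat_carrier[OF Wc[of m]] eval_mat_carrier[OF Wc[of n]]
          by (subst index_minus_mat) (auto simp: eval_mat_def)
        finally show ?case by simp
      qed
      then have "(\<Sum>k<n. N $$ (i, k) * W (Suc m) $$ (k, l)) = d * (W m $$ (i, l) - c m * W n $$ (i, l))"
        by (rule poly_eq_if_cofinite_real)
      from arg_cong[OF this, of "\<lambda>p. poly p \<alpha>"] show ?thesis
        using \<alpha>(2) Suc by (simp add: poly_sum)
    qed
  qed
  obtain N0 d0 where "frac N0 d0"
    using rat_mat_common_denominator[OF M] unfolding frac_def by metis
  with exists_least_iff[of "\<lambda>k. \<exists>N d. frac N d \<and> degree d = k"] obtain N d where fr: "frac N d"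
    and least: "\<And>N' d'. frac N' d' \<Longrightarrow> degree d \<le> degree d'"
    using \<open>frac N0 d0\<close> by (metis not_le)
  have N: "N \<in> carrier_mat n n" and d: "d \<noteq> 0" using fr by (auto simp: frac_def)
  have "degree d = 0"
  proof (rule ccontr)
    assume "degree d \<noteq> 0"
    then obtain \<alpha> where \<alpha>: "poly d \<alpha> = 0"
      using fundamental_theorem_of_algebra constant_degree by metis
    have N\<alpha>: "poly (N $$ (i, j)) \<alpha> = 0" if ij: "i < n" "j < n" for i j
    proof -
      consider "Im \<alpha> > 0" | "Im \<alpha> < 0" | "Im \<alpha> = 0" by linarith
      then show ?thesis
      proof cases
        case 1
        then show ?thesis using upper[OF fr _ \<alpha>] ij by blast
      next
        case 2
        \<comment> \<open>As \<open>M\<close> is Hermitian on the line, the adjoint of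
          \<open>N\<close> over the conjugate of \<open>d\<close> is another fraction for
          \<open>M\<close>, and its denominator has the root cnj \<alpha> in the upper
          half-plane.\<close>
        define N' where "N' = mat n n (\<lambda>(i, j). map_poly cnj (N $$ (j, i)))"
        have "frac N' (map_poly cnj d)" unfolding frac_def
        proof (intro conjI)
          show "N' \<in> carrier_mat n n" by (simp add: N'_def)
          show "map_poly cnj d \<noteq> 0" using d by (simp add: map_poly_eq_0_iff)
          have "\<forall>\<^sub>F x::real in cofinite. eval_mat N (of_real x) = poly d (of_real x) \<cdot>\<^sub>m M x"
            using fr by (simp add: frac_def)
          then show "\<forall>\<^sub>F x::real in cofinite. eval_mat N' (of_real x) = poly (map_poly cnj d) (of_real x) \<cdot>\<^sub>m M x"
            using herm
          proof eventually_elim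
            case (elim x)
            show ?case
            proof (rule eq_matI)
              fix i j assume "i < dim_row (poly (map_poly cnj d) (of_real x) \<cdot>\<^sub>m M x)" "j < dim_col (poly (map_poly cnj d) (of_real x) \<cdot>\<^sub>m M x)"
              then have ij: "i < n" "j < n" using Mc[of x] by auto
              have "M x $$ (i, j) = cnj (M x $$ (j, i))" using elim(2) ij by (intro hermitian_matD[OF Mc]) auto
              moreover have "poly (N $$ (j, i)) (of_real x) = poly d (of_real x) * M x $$ (j, i)"
                using arg_cong[OF elim(1), of "\<lambda>X. X $$ (j, i)"] ij N Mc[of x] by simp
              ultimately show "eval_mat N' (of_real x) $$ (i, j) = (poly (map_poly cnj d) (of_real x) \<cdot>\<^sub>m M x) $$ (i, j)"
                using ij Mc[of x] by (simp add: N'_def eval_mat_def)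
            qed (use Mc[of x] in \<open>auto simp: N'_def eval_mat_def\<close>)
          qed
        qed
        then have "poly (N' $$ (j, i)) (cnj \<alpha>) = 0"
          by (rule upper) (use 2 \<alpha> ij in auto)
        then show ?thesis using ij by (simp add: N'_def)
      next
        case 3
        then obtain a where a: "\<alpha> = of_real a" by (metis complex_is_Real_iff Reals_cases)
        \<comment> \<open>\<open>C k\<close> is the coefficient k of the reflected characteristic
          polynomial. The default 0 matters for n = 1, where \<open>C 2\<close> occurs and truncated
          subtraction would wrongly give \<open>c 0\<close>.\<close>
        define C where "C k = (if k \<le> n then c (n - k) else 0)" for k
        have "\<forall>\<^sub>F x in cofinite. (cmod (poly (N $$ (i, j)) (of_real x)))\<^sup>2 \<le>
            (cmod (poly d (of_real x)))\<^sup>2 * Re ((poly (C 1) (of_real x))\<^sup>2 - 2 * poly (C 2) (of_real x))"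
          using entry[OF fr ij] herm ev
        proof eventually_elim
          case (elim x)
          have "coeff (reflect_poly (char_poly (M x))) k = poly (C k) (of_real x)" for k
            using elim by (simp add: coeff_reflect_poly C_def q)
          then have "(cmod (M x $$ (i, j)))\<^sup>2 \<le> Re ((poly (C 1) (of_real x))\<^sup>2 - 2 * poly (C 2) (of_real x))"
            using hermitian_entry_bound[OF Mc _ ij, of x] elim by simp
          then show ?case unfolding elim(1) norm_mult power_mult_distrib by (intro mult_left_mono) auto
        qed
        \<comment> \<open>The inequality extends to the exceptional point \<open>a\<close> by
          continuity, and there d(a) = 0 makes the right side vanish.\<close>
        then have "(cmod (poly (N $$ (i, j)) (of_real a)))\<^sup>2 \<le>
            (cmod (poly d (of_real a)))\<^sup>2 * Re ((poly (C 1) (of_real a))\<^sup>2 - 2 * poly (C 2) (of_real a))"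
          by (rule continuous_le_if_cofinite) (intro continuous_intros isCont_Re isCont_poly_of_real)+
        then show ?thesis using \<alpha> by (simp add: a)
      qed
    qed
    define N' where "N' = mat n n (\<lambda>ij. N $$ ij div [:-\<alpha>, 1:])"
    define d' where "d' = d div [:-\<alpha>, 1:]"
    have div: "p = [:-\<alpha>, 1:] * (p div [:-\<alpha>, 1:])" if "poly p \<alpha> = 0" for p
      using that by (intro dvd_mult_div_cancel[symmetric]) (simp only: poly_eq_0_iff_dvd)
    have dd: "d = [:-\<alpha>, 1:] * d'" unfolding d'_def by (rule div[OF \<alpha>])
    then have d'0: "d' \<noteq> 0" using d by auto
    have "frac N' d'" unfolding frac_def
    proof (intro conjI d'0)
      show "N' \<in> carrier_mat n n" by (simp add: N'_def)
      have "\<forall>\<^sub>F x::real in cofinite. eval_mat N (of_real x) = poly d (of_real x) \<cdot>\<^sub>m M x"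
        using fr by (simp add: frac_def)
      moreover have "\<forall>\<^sub>F x::real in cofinite. poly [:-\<alpha>, 1:] (of_real x) \<noteq> 0"
        by (rule eventually_cofinite_poly_neq_0) simp
      ultimately show "\<forall>\<^sub>F x::real in cofinite. eval_mat N' (of_real x) = poly d' (of_real x) \<cdot>\<^sub>m M x"
      proof eventually_elim
        case (elim x)
        show ?case
        proof (rule eq_matI)
          fix i j assume "i < dim_row (poly d' (of_real x) \<cdot>\<^sub>m M x)" "j < dim_col (poly d' (of_real x) \<cdot>\<^sub>m M x)"
          then have ij: "i < n" "j < n" using Mc[of x] by auto
          have "poly (N $$ (i, j)) (of_real x) = poly d (of_real x) * M x $$ (i, j)"
            using arg_cong[OF elim(1), of "\<lambda>X. X $$ (i, j)"] ij N Mc[of x] by simp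
          then have "poly [:-\<alpha>, 1:] (of_real x) * poly (N' $$ (i, j)) (of_real x)
              = poly [:-\<alpha>, 1:] (of_real x) * (poly d' (of_real x) * M x $$ (i, j))"
            using ij by (subst (asm) div[OF N\<alpha>[OF ij]], subst (asm) dd) (simp only: poly_mult N'_def index_mat mult.assoc)
          then have "poly (N' $$ (i, j)) (of_real x) = poly d' (of_real x) * M x $$ (i, j)"
            using elim(2) mult_left_cancel by blast
          then show "eval_mat N' (of_real x) $$ (i, j) = (poly d' (of_real x) \<cdot>\<^sub>m M x) $$ (i, j)"
            using ij Mc[of x] by (simp add: N'_def eval_mat_def)
        qed (use Mc[of x] in \<open>auto simp: N'_def eval_mat_def\<close>)
      qed
    qed
    from least[OF this] have "degree d \<le> degree d'" .
    moreover have "degree d = Suc (degree d')" using d'0 by (subst dd, subst degree_mult_eq) auto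
    ultimately show False by simp
  qed
  then obtain e where e: "d = [:e:]" by (metis degree_eq_zeroE)
  with d have e0: "e \<noteq> 0" by auto
  define L where "L = map_mat (smult (1 / e)) N"
  have L: "L \<in> carrier_mat n n" using N by (simp add: L_def)
  have "\<forall>\<^sub>F x::real in cofinite. eval_mat N (of_real x) = poly d (of_real x) \<cdot>\<^sub>m M x"
    using fr by (simp add: frac_def)
  then have "\<forall>\<^sub>F x::real in cofinite. eval_mat L (of_real x) = M x"
  proof eventually_elim
    case (elim x)
    show ?case
    proof (rule eq_matI)
      fix i j assume "i < dim_row (M x)" "j < dim_col (M x)"
      then have ij: "i < n" "j < n" using Mc[of x] by auto
      have "poly (N $$ (i, j)) (of_real x) = e * M x $$ (i, j)"
        using arg_cong[OF elim(1), of "\<lambda>X. X $$ (i, j)"] ij N Mc[of x] by (simp add: e)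
      then show "eval_mat L (of_real x) $$ (i, j) = M x $$ (i, j)"
        using ij N e0 by (simp add: L_def eval_mat_def)
    qed (use Mc[of x] N in \<open>auto simp: L_def eval_mat_def\<close>)
  qed
  then have "\<forall>\<^sub>F x::real in cofinite. hermitian_mat (eval_mat L (of_real x)) \<and> char_poly (eval_mat L (of_real x)) = q x"
    using herm by eventually_elim simp
  with L show ?thesis by (rule that)
qed

section \<open>Determinantal representation\<close>

lemma poly_char_poly_eq_det:
  fixes A :: "complex mat"
  assumes A: "A \<in> carrier_mat n n"
  shows "poly (char_poly A) t = det (t \<cdot>\<^sub>m 1\<^sub>m n - A)"
proof -
  have C: "char_poly_matrix A \<in> carrier_mat n n" using A by simp
  have "eval_mat (char_poly_matrix A) t = t \<cdot>\<^sub>m 1\<^sub>m n - A"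
  proof (rule eq_matI)
    fix i j assume "i < dim_row (t \<cdot>\<^sub>m 1\<^sub>m n - A)" "j < dim_col (t \<cdot>\<^sub>m 1\<^sub>m n - A)"
    then have ij: "i < n" "j < n" using A by auto
    show "eval_mat (char_poly_matrix A) t $$ (i, j) = (t \<cdot>\<^sub>m 1\<^sub>m n - A) $$ (i, j)"
      unfolding eval_mat_index[OF C ij] char_poly_matrix_index[OF A ij] using ij A by auto
  qed (use carrier_matD[OF C] carrier_matD[OF A] in \<open>auto simp: eval_mat_def\<close>)
  then show ?thesis by (simp add: char_poly_def flip: det_eval_mat)
qed

section \<open>Expansion by total degree and homogenization\<close>

lemma coeff_eq_0_if_gt_total_degree:
  assumes "total_degree p < i + j" shows "coeff (coeff p j) i = 0"
proof (rule ccontr)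
  assume "coeff (coeff p j) i \<noteq> 0"
  then have "i + j \<le> total_degree p"
    unfolding total_degree_def by (intro Max_ge) (auto simp: finite_support)
  then show False using assms by simp
qed

lemma poly_eq_sum_atMost:
  fixes p :: "'a::comm_ring_1 poly"
  assumes "degree p \<le> d"
  shows "poly p x = (\<Sum>i\<le>d. coeff p i * x ^ i)"
  unfolding poly_altdef using assms
  by (intro sum.mono_neutral_left) (auto simp: coeff_eq_0)

text \<open>The terms outside the triangle i + j \<le> d vanish, so the sum over a square of
  exponents can be regrouped along its antidiagonals.\<close>

lemma eval2_eq_sum:
  fixes p :: "'a::comm_ring_1 poly poly"
  assumes z: "\<And>i j. d < i + j \<Longrightarrow> coeff (coeff p j) i = 0"
  shows "eval2 p x y = (\<Sum>m\<le>d. \<Sum>i\<le>m. coeff (coeff p (m - i)) i * x ^ i * y ^ (m - i))"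
proof -
  have "coeff p j = 0" if "j > d" for j
    by (rule poly_eqI) (use z that in auto)
  then have dp: "degree p \<le> d" by (intro degree_le) auto
  have dc: "degree (coeff p j) \<le> d" for j by (intro degree_le) (use z in auto)
  have "eval2 p x y = (\<Sum>j\<le>d. poly (coeff p j * [:y:] ^ j) x)"
    unfolding eval2_def poly_eq_sum_atMost[OF dp] poly_sum ..
  also have "\<dots> = (\<Sum>j\<le>d. \<Sum>i\<le>d. coeff (coeff p j) i * x ^ i * y ^ j)"
    by (rule sum.cong) (simp_all add: poly_eq_sum_atMost[OF dc] sum_distrib_right)
  also have "\<dots> = (\<Sum>i\<le>d. \<Sum>j\<le>d. coeff (coeff p j) i * x ^ i * y ^ j)" by (rule sum.swap)
  also have "\<dots> = (\<Sum>(i, j)\<in>{..d} \<times> {..d}. coeff (coeff p j) i * x ^ i * y ^ j)"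
    by (rule sum.cartesian_product)
  also have "\<dots> = (\<Sum>(i, j)\<in>{(i, j). i + j \<le> d}. coeff (coeff p j) i * x ^ i * y ^ j)"
    by (rule sum.mono_neutral_right) (auto, metis z mult_zero_left not_le)
  also have "\<dots> = (\<Sum>m\<le>d. \<Sum>i\<le>m. coeff (coeff p (m - i)) i * x ^ i * y ^ (m - i))"
    by (rule sum.triangle_reindex_eq)
  finally show ?thesis .
qed

text \<open>The coefficient of \<open>t ^ k\<close> in \<open>t ^ d * p (x / t, 1 / t)\<close>, as a polynomial in \<open>x\<close>.\<close>

definition homog_coeff :: "real poly poly \<Rightarrow> nat \<Rightarrow> nat \<Rightarrow> complex poly" where
  "homog_coeff p d k = (if k \<le> d then \<Sum>i\<le>d - k. monom (of_real (coeff (coeff p (d - k - i)) i)) i else 0)"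

text \<open>The polynomial \<open>q\<^sub>x(t)\<close> of the overview, assembled from its
  coefficients so that it makes sense at t = 0 too.\<close>

definition homog_poly :: "real poly poly \<Rightarrow> nat \<Rightarrow> real \<Rightarrow> complex poly" where
  "homog_poly p d x = (\<Sum>k\<le>d. monom (poly (homog_coeff p d k) (of_real x)) k)"

lemma coeff_homog_poly: "coeff (homog_poly p d x) k = poly (homog_coeff p d k) (of_real x)"
proof -
  have "coeff (homog_poly p d x) k = (\<Sum>l\<le>d. if k = l then poly (homog_coeff p d k) (of_real x) else 0)"
    unfolding homog_poly_def coeff_sum by (rule sum.cong) auto
  then show ?thesis by (simp add: homog_coeff_def)
qed

lemma degree_homog_coeff: "degree (homog_coeff p d k) \<le> d - k"
  unfolding homog_coeff_def
  by (auto intro!: degree_sum_le order.trans[OF degree_monom_le])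

lemma eval2_complexify:
  assumes "total_degree p = d"
  shows "eval2 (complexify p) x y =
    (\<Sum>m\<le>d. \<Sum>i\<le>m. of_real (coeff (coeff p (m - i)) i) * x ^ i * y ^ (m - i))"
proof -
  have c: "coeff (coeff (complexify p) j) i = of_real (coeff (coeff p j) i)" for i j
    by (simp add: complexify_def coeff_map_poly)
  show ?thesis
    using assms coeff_eq_0_if_gt_total_degree[of p]
    by (subst eval2_eq_sum[of d]) (auto simp: c)
qed

lemma eval2_complexify_of_real:
  assumes d: "total_degree p = d"
  shows "eval2 (complexify p) (of_real x) (of_real y) = of_real (eval2 p x y)"
proof -
  have "eval2 p x y = (\<Sum>m\<le>d. \<Sum>i\<le>m. coeff (coeff p (m - i)) i * x ^ i * y ^ (m - i))"
    by (rule eval2_eq_sum) (simp add: coeff_eq_0_if_gt_total_degree d)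
  then show ?thesis unfolding eval2_complexify[OF d] by simp
qed

lemma poly_homog_poly:
  assumes d: "total_degree p = d" and t: "t \<noteq> 0"
  shows "poly (homog_poly p d x) t = t ^ d * eval2 (complexify p) (of_real x / t) (1 / t)"
proof -
  have "poly (homog_poly p d x) t = (\<Sum>k\<le>d. poly (homog_coeff p d k) (of_real x) * t ^ k)"
    unfolding homog_poly_def by (simp add: poly_sum poly_monom)
  also have "\<dots> = (\<Sum>m\<le>d. poly (homog_coeff p d (d - m)) (of_real x) * t ^ (d - m))"
    by (rule sum.nat_diff_reindex[symmetric, of _ "Suc d", simplified lessThan_Suc_atMost diff_Suc_Suc])
  also have "\<dots> = (\<Sum>m\<le>d. \<Sum>i\<le>m. of_real (coeff (coeff p (m - i)) i) * of_real x ^ i * t ^ (d - m))"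
    by (rule sum.cong) (simp_all add: homog_coeff_def poly_sum poly_monom sum_distrib_right)
  also have "\<dots> = (\<Sum>m\<le>d. \<Sum>i\<le>m. t ^ d * (of_real (coeff (coeff p (m - i)) i) * (of_real x / t) ^ i * (1 / t) ^ (m - i)))"
  proof (intro sum.cong refl)
    fix m i assume "m \<in> {..d}" "i \<in> {..m}"
    then have m: "m \<le> d" "i \<le> m" by auto
    have "t ^ d = t ^ (d - m) * (t ^ i * t ^ (m - i))" using m by (simp flip: power_add)
    then show "of_real (coeff (coeff p (m - i)) i) * of_real x ^ i * t ^ (d - m)
      = t ^ d * (of_real (coeff (coeff p (m - i)) i) * (of_real x / t) ^ i * (1 / t) ^ (m - i))"
      using t by (simp add: power_divide)
  qed
  also have "\<dots> = t ^ d * eval2 (complexify p) (of_real x / t) (1 / t)"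
    unfolding eval2_complexify[OF d] by (simp only: sum_distrib_left)
  finally show ?thesis .
qed

theorem theorem4p1:
  fixes p :: "real poly poly" and d :: nat
  assumes "real_zero_poly p"
    and "total_degree p = d"
    and "d > 0"
    and "eval2 p 0 0 = 1"
  shows "\<exists>A1 A2 :: complex mat.
    A1 \<in> carrier_mat d d \<and> A2 \<in> carrier_mat d d \<and>
    hermitian_mat A1 \<and> hermitian_mat A2 \<and>
    (\<forall>x1 x2 :: real. complex_of_real (eval2 p x1 x2) =
       Determinant.det (1\<^sub>m d + complex_of_real x1 \<cdot>\<^sub>m A1 + complex_of_real x2 \<cdot>\<^sub>m A2))"
proof -
  define q where "q = homog_poly p d"
  define c where "c = homog_coeff p d"
  have qc: "coeff (q x) k = poly (c k) (of_real x)" for x k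
    unfolding q_def c_def by (rule coeff_homog_poly)
  \<comment> \<open>The constant term of \<open>p\<close> is the leading coefficient of
    \<open>q x\<close>, so the normalization p(0,0) = 1 makes \<open>q x\<close> monic of degree
    exactly \<open>d\<close>.\<close>
  have "coeff (coeff p 0) 0 = 1" using assms(4) by (simp add: eval2_def poly_0_coeff_0)
  then have top: "coeff (q x) d = 1" for x
    unfolding qc by (simp add: c_def homog_coeff_def monom_0 flip: one_pCons)
  have deg: "degree (q x) = d" for x
    using top[of x] by (intro antisym degree_le le_degree) (auto simp: qc c_def homog_coeff_def)
  \<comment> \<open>A nonzero root t of \<open>q x\<close> gives the zero 1/t of s \<mapsto> p(s x,
    s), which is real by hypothesis; t = 0 is real anyway.\<close>
  have roots: "t \<in> \<real>" if "poly (q x) t = 0" for x t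
  proof (cases "t = 0")
    case False
    then have "eval2 (complexify p) (1 / t * of_real x) (1 / t * of_real 1) = 0"
      using that poly_homog_poly[OF assms(2) False, of x] by (simp add: q_def)
    then have "1 / t \<in> \<real>" using assms(1) unfolding real_zero_poly_def by blast
    then have "1 / (1 / t) \<in> \<real>" by (rule Reals_divide[OF Reals_1])
    then show ?thesis by simp
  qed simp
  have "\<forall>\<^sub>F x in cofinite. degree (q x) = d \<and> coeff (q x) d = 1 \<and> (\<forall>z. poly (q x) z = 0 \<longrightarrow> z \<in> \<real>)"
    using deg top roots by (intro always_eventually) blast
  from hermitian_poly_mat_exists[OF assms(3) qc this] obtain N where N: "N \<in> carrier_mat d d"
    and evN: "\<forall>\<^sub>F x::real in cofinite. hermitian_mat (eval_mat N (of_real x)) \<and> char_poly (eval_mat N (of_real x)) = q x"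
    by blast
  have EN: "eval_mat N z \<in> carrier_mat d d" for z using N by simp

  \<comment> \<open>\<open>C k\<close> is the homogeneous part of degree k of \<open>p\<close> at
    (x, 1), hence of degree at most k in x. So C_1^2 - 2 C_2, which bounds the squared entries of
    \<open>N\<close>, has degree at most 2 and the entries are linear.\<close>
  define C where "C k = (if k \<le> d then c (d - k) else 0)" for k
  have degC: "degree (C k) \<le> k" for k
    using degree_homog_coeff[of p d "d - k"] by (auto simp: C_def c_def)
  have lin: "degree (N $$ (i, j)) \<le> 1" if ij: "i < d" "j < d" for i j
  proof (rule degree_le_1_if_square_bounded[where S = "C 1 * C 1 - smult 2 (C 2)"])
    have "degree (C 1 * C 1) \<le> 2" using degree_mult_le[of "C 1" "C 1"] degC[of 1] by linarith
    moreover have "degree (smult 2 (C 2)) \<le> 2" using degC[of 2] by (meson degree_smult_le le_trans)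
    ultimately show "degree (C 1 * C 1 - smult 2 (C 2)) \<le> 2" by (rule degree_diff_le)
    show "\<forall>\<^sub>F x::real in cofinite. (cmod (poly (N $$ (i, j)) (of_real x)))\<^sup>2 \<le> Re (poly (C 1 * C 1 - smult 2 (C 2)) (of_real x))"
      using evN
    proof eventually_elim
      case (elim x)
      have "coeff (reflect_poly (char_poly (eval_mat N (of_real x)))) k = poly (C k) (of_real x)" for k
        using elim by (simp add: coeff_reflect_poly C_def qc deg)
      then show ?case
        using hermitian_entry_bound[OF EN _ ij, of "of_real x"] elim N ij by (simp add: power2_eq_square)
    qed
  qed
  have Nval: "poly (N $$ (i, j)) z = coeff (N $$ (i, j)) 0 + coeff (N $$ (i, j)) 1 * z" if "i < d" "j < d" for i j z
    unfolding poly_eq_sum_atMost[OF lin[OF that]] by simp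
  have Nherm: "coeff (N $$ (i, j)) k = cnj (coeff (N $$ (j, i)) k)" if ij: "i < d" "j < d" for i j k
  proof -
    have "\<forall>\<^sub>F x::real in cofinite. poly (N $$ (i, j)) (of_real x) = poly (map_poly cnj (N $$ (j, i))) (of_real x)"
      using evN
    proof eventually_elim
      case (elim x)
      then show ?case using hermitian_matD[OF EN _ ij, of "of_real x"] N ij by simp
    qed
    then have "N $$ (i, j) = map_poly cnj (N $$ (j, i))" by (rule poly_eq_if_cofinite_real)
    then show ?thesis by (metis coeff_map_poly complex_cnj_zero)
  qed

  \<comment> \<open>The characteristic polynomial is known only for almost all x. For fixed t both
    sides are polynomials in x, so they agree everywhere.\<close>
  have detN: "det (t \<cdot>\<^sub>m 1\<^sub>m d - eval_mat N (of_real x)) = poly (q x) t" for t and x :: real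
  proof -
    define K where "K = [:t:] \<cdot>\<^sub>m 1\<^sub>m d - N"
    have K: "K \<in> carrier_mat d d" unfolding K_def using N by (rule minus_carrier_mat)
    have KE: "eval_mat K z = t \<cdot>\<^sub>m 1\<^sub>m d - eval_mat N z" for z
      by (rule eq_matI) (use N in \<open>auto simp: K_def eval_mat_def\<close>)
    define G where "G = (\<Sum>k\<le>d. smult (t ^ k) (c k))"
    have qG: "poly (q x) t = poly G (of_real x)" for x
      using poly_eq_sum_atMost[OF eq_refl[OF deg], of x t] by (simp add: G_def poly_sum qc mult.commute)
    have "\<forall>\<^sub>F x::real in cofinite. poly (det K) (of_real x) = poly G (of_real x)"
      using evN
    proof eventually_elim
      case (elim x)
      then show ?case using poly_char_poly_eq_det[OF EN, of "of_real x" t] by (simp add: qG KE flip: det_eval_mat)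
    qed
    then have "det K = G" by (rule poly_eq_if_cofinite_real)
    then show ?thesis by (simp add: qG det_eval_mat flip: KE)
  qed

  \<comment> \<open>Writing N = N_0 + x N_1 gives q_x(t) = det (t - N_0 - x N_1). Setting x = x1/x2
    and t = 1/x2 and multiplying by x2^d turns this into det (1 - x1 N_1 - x2 N_0), whence the
    signs.\<close>
  define A1 where "A1 = mat d d (\<lambda>ij. - coeff (N $$ ij) 1)"
  define A2 where "A2 = mat d d (\<lambda>ij. - coeff (N $$ ij) 0)"
  have A: "A1 \<in> carrier_mat d d" "A2 \<in> carrier_mat d d" by (simp_all add: A1_def A2_def)
  have "hermitian_mat A1" "hermitian_mat A2"
    unfolding hermitian_mat_iff[OF A(1)] hermitian_mat_iff[OF A(2)]
    by (auto simp: A1_def A2_def intro: Nherm)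
  moreover have ne: "complex_of_real (eval2 p x1 x2) =
      det (1\<^sub>m d + complex_of_real x1 \<cdot>\<^sub>m A1 + complex_of_real x2 \<cdot>\<^sub>m A2)" if x2: "x2 \<noteq> 0" for x1 x2 :: real
  proof -
    define t where "t = complex_of_real (1 / x2)"
    have t: "t \<noteq> 0" using x2 by (simp add: t_def)
    have "1\<^sub>m d + complex_of_real x1 \<cdot>\<^sub>m A1 + complex_of_real x2 \<cdot>\<^sub>m A2
        = complex_of_real x2 \<cdot>\<^sub>m (t \<cdot>\<^sub>m 1\<^sub>m d - eval_mat N (of_real (x1 / x2)))"
      by (rule eq_matI)
         (use N x2 in \<open>auto simp: A1_def A2_def eval_mat_def Nval t_def algebra_simps\<close>)
    then have "det (1\<^sub>m d + complex_of_real x1 \<cdot>\<^sub>m A1 + complex_of_real x2 \<cdot>\<^sub>m A2)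
        = of_real x2 ^ d * poly (q (x1 / x2)) t"
      using detN[of t "x1 / x2"] carrier_matD[OF EN] by simp
    also have "\<dots> = (of_real x2 * t) ^ d * eval2 (complexify p) (of_real (x1 / x2) / t) (1 / t)"
      unfolding q_def poly_homog_poly[OF assms(2) t] by (simp add: power_mult_distrib)
    also have "\<dots> = eval2 (complexify p) (of_real x1) (of_real x2)" using x2 by (simp add: t_def)
    finally show ?thesis by (simp add: eval2_complexify_of_real[OF assms(2)])
  qed
  \<comment> \<open>The line x2 = 0, excluded by the substitution t = 1/x2, is recovered by fixing
    x1: both sides are polynomials in x2 that agree for x2 \<noteq> 0.\<close>
  moreover have "complex_of_real (eval2 p x1 x2) =
      det (1\<^sub>m d + complex_of_real x1 \<cdot>\<^sub>m A1 + complex_of_real x2 \<cdot>\<^sub>m A2)" for x1 x2 :: real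
  proof -
    define K where "K = mat d d (\<lambda>(i, j). [:(1\<^sub>m d + complex_of_real x1 \<cdot>\<^sub>m A1) $$ (i, j), A2 $$ (i, j):])"
    have KE: "eval_mat K z = 1\<^sub>m d + complex_of_real x1 \<cdot>\<^sub>m A1 + z \<cdot>\<^sub>m A2" for z
      by (rule eq_matI) (use A in \<open>auto simp: K_def eval_mat_def\<close>)
    define G where "G = (\<Sum>m\<le>d. \<Sum>i\<le>m. monom (complex_of_real (coeff (coeff p (m - i)) i) * of_real x1 ^ i) (m - i))"
    have G: "poly G (of_real y) = of_real (eval2 p x1 y)" for y
      unfolding eval2_complexify_of_real[OF assms(2), symmetric] eval2_complexify[OF assms(2)]
      by (simp add: G_def poly_sum poly_monom)
    have "\<forall>\<^sub>F y in cofinite. y \<noteq> (0::real)" by (simp add: eventually_cofinite)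
    then have "\<forall>\<^sub>F y::real in cofinite. poly G (of_real y) = poly (det K) (of_real y)"
    proof eventually_elim
      case (elim y)
      from ne[OF elim, of x1] show ?case by (simp only: G KE flip: det_eval_mat)
    qed
    then have "G = det K" by (rule poly_eq_if_cofinite_real)
    then show ?thesis by (simp add: det_eval_mat flip: G KE)
  qed
  ultimately show ?thesis using A by blast
qed

end
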